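(* Let $R>0$ and let $g\colon[a,b]\to\mathbb{R}^2$ be an $R$-path. Then $g$ is an $R$-curve (in particular, $g$ is rectifiable).
   Context: Notation: $B(z,\rho)$ is the open disk in $\mathbb{R}^2$ of center $z$ and radius $\rho$. For a nonempty closed set $K\subset\mathbb{R}^2$ and $q\in K$, the tangent cone is $$\mathrm{Tan}(K,q)=\{v\in\mathbb{R}^2:\forall\varepsilon>0\ \exists x\in K,\ r>0\text{ with }|x-q|<\varepsilon,\ |r(x-q)-v|<\varepsilon\}.$$ $R$-path: let $R>0$. A continuous map $g\colon[a,b]\to\mathbb{R}^2$ with $g(a)\ne g(b)$ is an $R$-path if for every $t\in[a,b]$, writing $x=g(t)$, and for every unit vector $l\in\big[-\mathrm{Tan}(g([a,t]),x)\big]\cup\mathrm{Tan}(g([t,b]),x)$, one has $g([a,t])\cap B(x+Rl,R)=\varnothing$. $R$-curve: a rectifiable oriented plane curve (oriented by its increasing parameter) whose arc length representation $x\colon[0,L]\to\mathbb{R}^2$ satisfies, for almost all $s\in[0,L]$ and all $0\le s_1\le s$, the inequality $|x(s_1)-x(s)-R\,x'(s)|\ge R$. *)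

theory Defs
  imports "HOL-Analysis.Analysis"
begin

definition tangent_cone :: "(real^2) set \<Rightarrow> real^2 \<Rightarrow> (real^2) set" where
  "tangent_cone K q =
     {v. \<forall>\<epsilon>>0. \<exists>x\<in>K. \<exists>r>0. norm (x - q) < \<epsilon> \<and> norm (r *\<^sub>R (x - q) - v) < \<epsilon>}"

definition R_path :: "real \<Rightarrow> real \<Rightarrow> real \<Rightarrow> (real \<Rightarrow> real^2) \<Rightarrow> bool" where
  "R_path R a b g \<longleftrightarrow>
     a < b \<and> continuous_on {a..b} g \<and> g a \<noteq> g b \<and>
     (\<forall>t\<in>{a..b}. \<forall>l \<in> uminus ` tangent_cone (g ` {a..t}) (g t) \<union> tangent_cone (g ` {t..b}) (g t).
        norm l = 1 \<longrightarrow> g ` {a..t} \<inter> ball (g t + R *\<^sub>R l) R = {})"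

definition inscribed_lengths :: "(real \<Rightarrow> real^2) \<Rightarrow> real \<Rightarrow> real \<Rightarrow> real set" where
  "inscribed_lengths g a b =
     {\<Sum>i<n. dist (g (p i)) (g (p (Suc i))) | (n::nat) p.
        mono_on {..n} p \<and> p 0 = a \<and> p n = b}"

definition rectifiable :: "(real \<Rightarrow> real^2) \<Rightarrow> real \<Rightarrow> real \<Rightarrow> bool" where
  "rectifiable g a b \<longleftrightarrow> bdd_above (inscribed_lengths g a b)"

text \<open>Meaningful only for rectifiable curves, since \<open>Sup\<close> on the reals is unspecified
  on unbounded sets.\<close>

definition arc_length :: "(real \<Rightarrow> real^2) \<Rightarrow> real \<Rightarrow> real \<Rightarrow> real" where
  "arc_length g a b = Sup (inscribed_lengths g a b)"

text \<open>For a continuous rectifiable \<open>g\<close>, the map \<open>t \<mapsto> arc_length g a t\<close> sends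
  \<open>{a..b}\<close> onto \<open>{0..arc_length g a b}\<close>, so the following condition determines \<open>x\<close>
  uniquely on that interval; values of \<open>x\<close> outside it are irrelevant below.\<close>

definition arc_length_representation ::
    "(real \<Rightarrow> real^2) \<Rightarrow> real \<Rightarrow> real \<Rightarrow> (real \<Rightarrow> real^2) \<Rightarrow> bool" where
  "arc_length_representation g a b x \<longleftrightarrow> (\<forall>t\<in>{a..b}. x (arc_length g a t) = g t)"

definition R_curve :: "real \<Rightarrow> real \<Rightarrow> real \<Rightarrow> (real \<Rightarrow> real^2) \<Rightarrow> bool" where
  "R_curve R a b g \<longleftrightarrow>
     a < b \<and> continuous_on {a..b} g \<and> rectifiable g a b \<and>
     (\<exists>x. arc_length_representation g a b x \<and>
       (AE s in lebesgue_on {0..arc_length g a b}.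
          \<exists>v. (x has_vector_derivative v) (at s within {0..arc_length g a b}) \<and>
              (\<forall>s1\<in>{0..s}. norm (x s1 - x s - R *\<^sub>R v) \<ge> R)))"

end

(* Near a point of the path, every unit forward tangent l makes an angle of at least about pi/2 with
   the directions to all earlier points that are close, so a short forward step of length d decreases
   distances to them by at most eps * d. If distances to the past do not drop much, the triangle formed
   by two past points and the current one shows that the past is seen under an angle of at most about
   pi/2; hence the width of the past grows by a fixed multiple of d at each step. As the total width
   is bounded by the diameter, this bounds the length, and the length in turn bounds the drop of the
   distances. The circle is closed along a transfinite increasing chain of parameters (only the forward
   tangents are used, and the steps they allow have no uniform lower bound), which is obtained by
   Zorn's lemma; local length bounds then give rectifiability and continuity of the arc length.

   For the arc length parametrization x, inscribed polygons of almost full length and the Vitali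
   covering theorem show that off a set of small measure all small difference quotients are close to a
   unit vector. So x' exists with norm 1 almost everywhere; it is then a forward tangent, and the
   R-path condition for it is the R-curve inequality. *)

theory Submission
  imports Defs
begin

subsection \<open>Widths of plane sets\<close>

text \<open>The direction is the point of smallest norm in the convex hull of \<open>V\<close>; by Caratheodory's theorem
  at most three vectors enter a convex combination, which keeps its norm away from zero.\<close>

lemma unit_vectors_common_direction:
  fixes V :: "(real^2) set"
  assumes V: "V \<noteq> {}" "\<And>v. v \<in> V \<Longrightarrow> norm v = 1"
    and inn: "\<And>v w. v \<in> V \<Longrightarrow> w \<in> V \<Longrightarrow> v \<bullet> w \<ge> - (1/12)"
  shows "\<exists>w. norm w = 1 \<and> (\<forall>v\<in>V. w \<bullet> v \<ge> 1/2)"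
proof -
  have hull: "norm y \<ge> 1/2" if y: "y \<in> convex hull V" for y
  proof -
    from y obtain S u where S: "finite S" "S \<subseteq> V" "card S \<le> DIM(real^2) + 1"
        "\<forall>x\<in>S. 0 \<le> u x" "sum u S = 1" "(\<Sum>v\<in>S. u v *\<^sub>R v) = y"
      unfolding convex_hull_caratheodory by blast
    \<comment> \<open>The diagonal value 1 is written as -1/12 + 13/12, so the double sum becomes
      -1/12 times the square of the total weight 1 plus 13/12 times the sum of the squared weights.
      With at most three weights the latter sum is at least 1/3, and 13/36 - 1/12 = 5/18 exceeds
      1/4.\<close>
    have pt: "u v * u w * (v \<bullet> w) \<ge> - (1/12) * (u v * u w) + (if v = w then (13/12) * (u v)\<^sup>2 else 0)"
      if "v \<in> S" "w \<in> S" for v w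
    proof (cases "v = w")
      case True
      then have "v \<bullet> w = 1" using V(2) S(2) that by (metis norm_eq_1 subsetD)
      then show ?thesis using True by (simp add: power2_eq_square)
    next
      case False
      have "u v * u w * (v \<bullet> w) \<ge> u v * u w * (-(1/12))"
        by (intro mult_left_mono inn mult_nonneg_nonneg) (use S that in auto)
      then show ?thesis using False by simp
    qed
    have "1 = (\<Sum>v\<in>S. 1 * u v)\<^sup>2" using S by simp
    also have "\<dots> \<le> (\<Sum>v\<in>S. 1\<^sup>2) * (\<Sum>v\<in>S. (u v)\<^sup>2)"
      by (rule Cauchy_Schwarz_ineq_sum)
    also have "\<dots> \<le> 3 * (\<Sum>v\<in>S. (u v)\<^sup>2)"
      using S(3) by (intro mult_right_mono sum_nonneg) auto
    finally have sq: "(\<Sum>v\<in>S. (u v)\<^sup>2) \<ge> 1/3" by simp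
    have "y \<bullet> y = (\<Sum>v\<in>S. \<Sum>w\<in>S. u v * u w * (v \<bullet> w))"
      unfolding S(6)[symmetric] inner_sum_left inner_sum_right
      by (rule sum.cong[OF refl], rule sum.cong[OF refl]) (simp add: inner_commute mult_ac)
    also have "\<dots> \<ge> (\<Sum>v\<in>S. \<Sum>w\<in>S. - (1/12) * (u v * u w) + (if v = w then (13/12) * (u v)\<^sup>2 else 0))"
      by (intro sum_mono pt)
    also have "(\<Sum>v\<in>S. \<Sum>w\<in>S. - (1/12) * (u v * u w) + (if v = w then (13/12) * (u v)\<^sup>2 else 0))
       = (\<Sum>v\<in>S. \<Sum>w\<in>S. - (1/12) * (u v * u w)) + (\<Sum>v\<in>S. (13/12) * (u v)\<^sup>2)"
      unfolding sum.distrib by (simp add: S(1))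
    also have "\<dots> = - (1/12) * (sum u S * sum u S) + (13/12) * (\<Sum>v\<in>S. (u v)\<^sup>2)"
      by (subst sum_product) (simp only: sum_distrib_left)
    finally have "y \<bullet> y \<ge> (1/2)\<^sup>2" using S(5) sq by (simp add: power2_eq_square)
    then have "(1/2)\<^sup>2 \<le> (norm y)\<^sup>2" by (simp only: power2_norm_eq_inner)
    then show ?thesis by (rule power2_le_imp_le) simp
  qed
  let ?C = "closure (convex hull V)"
  have C: "convex ?C" "closed ?C" "?C \<noteq> {}"
    using V(1) by (auto simp: convex_closure)
  obtain w0 where w0: "w0 \<in> ?C" "\<forall>z\<in>?C. dist 0 w0 \<le> dist 0 z"
    using distance_attains_inf[OF C(2,3), of 0] by metis
  have "closed {y :: real^2. norm y \<ge> 1/2}"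
    by (intro closed_Collect_le continuous_intros)
  then have "?C \<subseteq> {y. norm y \<ge> 1/2}"
    using hull by (intro closure_minimal) blast
  then have n: "norm w0 \<ge> 1/2" using w0(1) by auto
  \<comment> \<open>Nearest point property: the direction from \<open>w0\<close> to 0 makes no acute
    angle with a direction from \<open>w0\<close> into the convex set.\<close>
  have sq: "w0 \<bullet> v \<ge> (norm w0)\<^sup>2" if "v \<in> V" for v
  proof -
    have "v \<in> ?C" using that by (meson closure_subset hull_subset subsetD)
    from any_closest_point_dot[OF C(1,2) w0(1) this w0(2)] show ?thesis
      by (simp add: inner_diff_right power2_norm_eq_inner)
  qed
  have "(w0 /\<^sub>R norm w0) \<bullet> v \<ge> norm w0" if "v \<in> V" for v
  proof -
    have "norm w0 > 0" using n by linarith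
    moreover have "(w0 /\<^sub>R norm w0) \<bullet> v = (w0 \<bullet> v) / norm w0" by (simp add: divide_inverse mult.commute)
    ultimately show ?thesis using sq[OF that] by (simp add: pos_le_divide_eq power2_eq_square)
  qed
  then have "\<forall>v\<in>V. (w0 /\<^sub>R norm w0) \<bullet> v \<ge> 1/2" using n by (meson order_trans)
  moreover have "w0 \<noteq> 0" using n by auto
  then have "norm (w0 /\<^sub>R norm w0) = 1" by simp
  ultimately show ?thesis by blast
qed

text \<open>A discrete substitute for the mean width of the convex hull of \<open>Y\<close>, with the average over all
  directions replaced by a sum over a finite net \<open>N\<close>.\<close>

definition width :: "(real^2) set \<Rightarrow> (real^2) set \<Rightarrow> real" where
  "width N Y = (\<Sum>u\<in>N. SUP y\<in>Y. u \<bullet> y)"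

lemma bdd_above_inner_image:
  assumes "bounded (Y :: (real^2) set)" shows "bdd_above ((\<bullet>) u ` Y)"
  by (intro bounded_imp_bdd_above bounded_linear_image assms bounded_linear_inner_right)

lemma width_mono:
  assumes "Y \<subseteq> Z" "Y \<noteq> {}" "bounded Z"
  shows "width N Y \<le> width N Z"
  unfolding width_def
  by (intro sum_mono cSUP_subset_mono bdd_above_inner_image assms) auto

lemma width_le:
  assumes "bounded Y" "Z \<noteq> {}" and near: "\<And>z. z \<in> Z \<Longrightarrow> \<exists>y\<in>Y. dist z y \<le> D"
  shows "width N Z \<le> width N Y + D * (\<Sum>u\<in>N. norm u)"
proof -
  have "(SUP z\<in>Z. u \<bullet> z) \<le> (SUP y\<in>Y. u \<bullet> y) + D * norm u" for u
  proof (rule cSUP_least[OF assms(2)])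
    fix z assume "z \<in> Z"
    then obtain y where y: "y \<in> Y" "dist z y \<le> D" using near by blast
    have "u \<bullet> z = u \<bullet> y + u \<bullet> (z - y)" by (simp add: inner_diff_right)
    also have "u \<bullet> (z - y) \<le> norm u * dist z y"
      using norm_cauchy_schwarz[of u "z - y"] by (simp add: dist_norm)
    also have "\<dots> \<le> D * norm u" using mult_right_mono[OF y(2) norm_ge_zero[of u]] by (simp add: mult.commute)
    also have "u \<bullet> y \<le> (SUP y\<in>Y. u \<bullet> y)"
      using y(1) by (intro cSUP_upper bdd_above_inner_image assms(1))
    finally show "u \<bullet> z \<le> (SUP y\<in>Y. u \<bullet> y) + D * norm u" by simp
  qed
  then have "width N Z \<le> (\<Sum>u\<in>N. (SUP y\<in>Y. u \<bullet> y) + D * norm u)"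
    unfolding width_def by (intro sum_mono)
  then show ?thesis by (simp add: width_def sum.distrib sum_distrib_left)
qed

text \<open>The unit vectors pointing from \<open>Y\<close> to \<open>x\<close> have inner products
  at least 1/2 with a common direction \<open>w\<close>. A net vector \<open>u\<close> within 1/4 of
  \<open>w\<close> keeps inner products at least 1/4, so the supremum along \<open>u\<close> grows
  by at least \<open>\<rho> / 4\<close> and the others do not decrease. The case
  \<open>\<rho> = 0\<close> is separate because \<open>x\<close> may then lie in \<open>Y\<close>,
  where there is no unit vector to take.\<close>

lemma width_insert_growth:
  assumes N: "finite N" "sphere 0 1 \<subseteq> (\<Union>u\<in>N. ball u (1/4))"
    and Y: "Y \<noteq> {}" "bounded Y"
    and far: "\<And>y. y \<in> Y \<Longrightarrow> dist x y \<ge> \<rho>" "0 \<le> \<rho>"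
    and obt: "\<And>y z. y \<in> Y \<Longrightarrow> z \<in> Y \<Longrightarrow> (x - y) \<bullet> (x - z) \<ge> - (1/12) * (dist x y * dist x z)"
  shows "width N Y + \<rho> / 4 \<le> width N (insert x Y)"
proof (cases "\<rho> = 0")
  case True
  then show ?thesis using width_mono[of Y "insert x Y" N] Y by auto
next
  case False
  then have pos: "\<rho> > 0" using far(2) by simp
  have ne: "dist x y > 0" if "y \<in> Y" for y using far(1)[OF that] pos by linarith
  let ?V = "(\<lambda>y. (x - y) /\<^sub>R dist x y) ` Y"
  have "\<exists>w. norm w = 1 \<and> (\<forall>v\<in>?V. w \<bullet> v \<ge> 1/2)"
  proof (rule unit_vectors_common_direction[of ?V])
    show "?V \<noteq> {}" using Y by simp
    show "norm v = 1" if "v \<in> ?V" for v using that ne by (force simp: dist_norm)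
    show "v \<bullet> v' \<ge> - (1/12)" if vv: "v \<in> ?V" "v' \<in> ?V" for v v'
    proof -
      obtain y z where yz: "y \<in> Y" "z \<in> Y" "v = (x - y) /\<^sub>R dist x y" "v' = (x - z) /\<^sub>R dist x z"
        using vv by auto
      have "v \<bullet> v' = ((x - y) \<bullet> (x - z)) / (dist x y * dist x z)"
        unfolding yz(3,4) by (simp add: divide_inverse)
      then show ?thesis
        using obt[OF yz(1,2)] ne[OF yz(1)] ne[OF yz(2)] by (simp add: pos_le_divide_eq)
    qed
  qed
  then obtain w where w: "norm w = 1" "\<And>v. v \<in> ?V \<Longrightarrow> w \<bullet> v \<ge> 1/2" by blast
  obtain u where u: "u \<in> N" "dist u w < 1/4" using N(2) w(1) by fastforce
  have key: "u \<bullet> y \<le> u \<bullet> x - \<rho> / 4" if y: "y \<in> Y" for y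
  proof -
    have "dist x y / 2 \<le> w \<bullet> (x - y)"
    proof -
      have "1/2 \<le> w \<bullet> ((x - y) /\<^sub>R dist x y)" using w(2) y by blast
      also have "\<dots> = (w \<bullet> (x - y)) / dist x y" by (simp add: divide_inverse mult.commute)
      finally show ?thesis using ne[OF y] by (simp add: pos_le_divide_eq)
    qed
    moreover have "(w - u) \<bullet> (x - y) \<le> (1/4) * dist x y"
    proof -
      have "(w - u) \<bullet> (x - y) \<le> norm (w - u) * norm (x - y)" by (rule norm_cauchy_schwarz)
      also have "\<dots> \<le> (1/4) * dist x y"
        using u(2) unfolding dist_norm by (intro mult_right_mono) (auto simp: norm_minus_commute)
      finally show ?thesis .
    qed
    ultimately have "u \<bullet> (x - y) \<ge> dist x y / 4" by (simp add: inner_diff_left)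
    then show ?thesis using far(1)[OF y] by (simp add: inner_diff_right)
  qed
  have bd: "bounded (insert x Y)" using Y by simp
  have "width N Y = (SUP y\<in>Y. u \<bullet> y) + (\<Sum>u\<in>N - {u}. SUP y\<in>Y. u \<bullet> y)"
    unfolding width_def using u(1) N(1) by (simp add: sum.remove)
  also have "(SUP y\<in>Y. u \<bullet> y) \<le> u \<bullet> x - \<rho> / 4" using Y(1) key by (intro cSUP_least)
  also have "u \<bullet> x \<le> (SUP y\<in>insert x Y. u \<bullet> y)"
    by (intro cSUP_upper bdd_above_inner_image bd) auto
  also have "(\<Sum>u\<in>N - {u}. SUP y\<in>Y. u \<bullet> y) \<le> (\<Sum>u\<in>N - {u}. SUP y\<in>insert x Y. u \<bullet> y)"
    by (intro sum_mono cSUP_subset_mono bdd_above_inner_image bd Y) auto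
  also have "(SUP y\<in>insert x Y. u \<bullet> y) - \<rho> / 4 + (\<Sum>u\<in>N - {u}. SUP y\<in>insert x Y. u \<bullet> y)
      = width N (insert x Y) - \<rho> / 4"
    unfolding width_def using u(1) N(1) by (simp add: sum.remove)
  finally show ?thesis by simp
qed

subsection \<open>Tame sets of parameters\<close>

definition past_width :: "(real^2) set \<Rightarrow> (real \<Rightarrow> real^2) \<Rightarrow> real set \<Rightarrow> real \<Rightarrow> real" where
  "past_width N g P p = width N (g ` (P \<inter> {..p}))"

text \<open>Distances to earlier points of \<open>P\<close> drop by at most \<open>K\<close> times the growth of the width
  of the past; since that growth is additive along \<open>P\<close>, the condition passes to concatenations
  and limits.\<close>

definition tame :: "real \<Rightarrow> (real^2) set \<Rightarrow> (real \<Rightarrow> real^2) \<Rightarrow> real set \<Rightarrow> bool" where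
  "tame K N g P \<longleftrightarrow>
     (\<forall>r\<in>P. \<forall>p\<in>P. \<forall>q\<in>P. r \<le> p \<longrightarrow> p \<le> q \<longrightarrow>
        dist (g p) (g r) \<le> dist (g q) (g r) + K * (past_width N g P q - past_width N g P p))"

lemma past_width_mono:
  assumes "bounded (g ` P)" "p \<in> P" "p \<le> q"
  shows "past_width N g P p \<le> past_width N g P q"
  unfolding past_width_def
proof (rule width_mono)
  show "bounded (g ` (P \<inter> {..q}))" by (rule bounded_subset[OF assms(1)]) auto
qed (use assms in auto)

text \<open>An absorption argument: let \<open>D\<close> be the supremum of the distances from
  \<open>g p\<close> on \<open>P \<inter> {p..q}\<close>. The width grows by at most
  \<open>D * B\<close>, so tameness with \<open>r = p\<close> bounds \<open>D\<close> by
  \<open>dist (g q) (g p)\<close> plus \<open>K * B * D\<close>, and \<open>K * B \<le> 1/48\<close>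
  absorbs the last term.\<close>

lemma tame_past_width_le:
  assumes tame: "tame K N g P" and bd: "bounded (g ` P)"
    and B: "(\<Sum>u\<in>N. norm u) \<le> B" and K: "0 \<le> K" "K * B \<le> 1/48"
    and pq: "p \<in> P" "q \<in> P" "p \<le> q"
  shows "past_width N g P q - past_width N g P p \<le> 2 * B * dist (g q) (g p)"
proof -
  let ?w = "past_width N g P"
  define D where "D = (SUP \<tau>\<in>P \<inter> {p..q}. dist (g \<tau>) (g p))"
  have "bounded ((\<lambda>\<tau>. dist (g \<tau>) (g p)) ` (P \<inter> {p..q}))"
  proof -
    have "bounded (g ` (P \<inter> {p..q}))" by (rule bounded_subset[OF bd]) auto
    then obtain e where "\<forall>y\<in>g ` (P \<inter> {p..q}). dist (g p) y \<le> e" 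
      using bounded_any_center[where a = "g p"] by blast
    then show ?thesis by (intro boundedI[where B = e]) (auto simp: dist_commute)
  qed
  then have bda: "bdd_above ((\<lambda>\<tau>. dist (g \<tau>) (g p)) ` (P \<inter> {p..q}))"
    by (rule bounded_imp_bdd_above)
  have D: "dist (g \<tau>) (g p) \<le> D" if "\<tau> \<in> P" "p \<le> \<tau>" "\<tau> \<le> q" for \<tau>
    unfolding D_def using that by (intro cSUP_upper bda) auto
  have D0: "0 \<le> D" using D[of p] pq by simp
  have B0: "0 \<le> B" using B by (meson norm_ge_zero order_trans sum_nonneg)
  have "?w q \<le> ?w p + D * (\<Sum>u\<in>N. norm u)"
    unfolding past_width_def
  proof (rule width_le)
    show "bounded (g ` (P \<inter> {..p}))" by (rule bounded_subset[OF bd]) auto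
    show "g ` (P \<inter> {..q}) \<noteq> {}" using pq by auto
    fix z assume "z \<in> g ` (P \<inter> {..q})"
    then obtain \<tau> where \<tau>: "\<tau> \<in> P" "\<tau> \<le> q" "z = g \<tau>" by auto
    show "\<exists>y\<in>g ` (P \<inter> {..p}). dist z y \<le> D"
    proof (cases "\<tau> \<le> p")
      case True
      then show ?thesis using \<tau> D0 by (intro bexI[of _ z]) auto
    next
      case False
      then show ?thesis using \<tau> D pq by (intro bexI[of _ "g p"]) auto
    qed
  qed
  also have "D * (\<Sum>u\<in>N. norm u) \<le> D * B" using B D0 by (rule mult_left_mono)
  finally have w: "?w q - ?w p \<le> D * B" by simp
  have "D \<le> dist (g q) (g p) + K * (?w q - ?w p)"
    unfolding D_def
  proof (rule cSUP_least)
    show "P \<inter> {p..q} \<noteq> {}" using pq by auto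
    fix \<tau> assume \<tau>: "\<tau> \<in> P \<inter> {p..q}"
    then have "dist (g \<tau>) (g p) \<le> dist (g q) (g p) + K * (?w q - ?w \<tau>)"
      using tame pq unfolding tame_def by auto
    also have "K * (?w q - ?w \<tau>) \<le> K * (?w q - ?w p)"
      using past_width_mono[OF bd pq(1), of \<tau> N] \<tau> K by (intro mult_left_mono) auto
    finally show "dist (g \<tau>) (g p) \<le> dist (g q) (g p) + K * (?w q - ?w p)" by simp
  qed
  also have "K * (?w q - ?w p) \<le> K * (D * B)" using w K(1) by (rule mult_left_mono)
  also have "K * (D * B) \<le> D * (1/48)"
    using mult_left_mono[OF K(2) D0] by (simp add: mult_ac)
  finally have "D \<le> 2 * dist (g q) (g p)" using zero_le_dist[of "g q" "g p"] by linarith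
  then have "D * B \<le> 2 * dist (g q) (g p) * B" using B0 by (rule mult_right_mono)
  then show ?thesis using w by (simp add: mult_ac)
qed

text \<open>Eliminates the width from tameness: the loss is at most \<open>2 * K * B\<close> times
  the chord, and 2/48 = 1/24.\<close>

lemma tame_dist_le:
  assumes tame: "tame K N g P" and bd: "bounded (g ` P)"
    and B: "(\<Sum>u\<in>N. norm u) \<le> B" and K: "0 \<le> K" "K * B \<le> 1/48"
    and rpq: "r \<in> P" "p \<in> P" "q \<in> P" "r \<le> p" "p \<le> q"
  shows "dist (g p) (g r) \<le> dist (g q) (g r) + dist (g q) (g p) / 24"
proof -
  have "dist (g p) (g r) \<le> dist (g q) (g r) + K * (past_width N g P q - past_width N g P p)"
    using tame rpq unfolding tame_def by auto
  also have "K * (past_width N g P q - past_width N g P p) \<le> K * (2 * B * dist (g q) (g p))"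
    using tame_past_width_le[OF tame bd B K rpq(2,3,5)] K(1) by (rule mult_left_mono)
  also have "\<dots> = 2 * dist (g q) (g p) * (K * B)" by simp
  also have "\<dots> \<le> 2 * dist (g q) (g p) * (1/48)" using K(2) by (intro mult_left_mono) auto
  finally show ?thesis by simp
qed

text \<open>Law of cosines at \<open>x\<close>; after squaring the hypothesis, the terms in
  \<open>(dist x z)\<^sup>2\<close> leave a nonnegative surplus. This turns a small loss of distance
  into a bound on the angle under which two past points are seen.\<close>

lemma inner_ge_of_dist_le:
  fixes x y z :: "'a::real_inner"
  assumes "dist y z \<le> dist x y + dist x z / 12"
  shows "(x - y) \<bullet> (x - z) \<ge> - (1/12) * (dist x y * dist x z)"
proof -
  have "(dist y z)\<^sup>2 \<le> (dist x y + dist x z / 12)\<^sup>2"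
    using assms by (intro power_mono) auto
  moreover have "(dist y z)\<^sup>2 = (dist x y)\<^sup>2 + (dist x z)\<^sup>2 - 2 * ((x - y) \<bullet> (x - z))"
    unfolding dist_norm power2_norm_eq_inner by (simp add: inner_diff inner_commute algebra_simps)
  ultimately have "2 * ((x - y) \<bullet> (x - z)) \<ge> (dist x y)\<^sup>2 + (dist x z)\<^sup>2 - (dist x y + dist x z / 12)\<^sup>2"
    by linarith
  also have "(dist x y)\<^sup>2 + (dist x z)\<^sup>2 - (dist x y + dist x z / 12)\<^sup>2
      = (143/144) * (dist x z)\<^sup>2 - (1/6) * (dist x y * dist x z)"
    by (simp add: power2_eq_square algebra_simps)
  finally show ?thesis using zero_le_power2[of "dist x z"] by linarith
qed

text \<open>By \<open>tame_dist_le\<close> and the law of cosines, two past points are seen from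
  \<open>g q\<close> under an angle with cosine at least -1/12, so
  \<open>width_insert_growth\<close> applies. By \<open>near\<close> and the triangle inequality,
  \<open>g q\<close> has distance at least 23/48 of the chord from the past; a quarter is used,
  whence 1/16.\<close>

lemma tame_past_width_ge:
  assumes N: "finite N" "sphere 0 1 \<subseteq> (\<Union>u\<in>N. ball u (1/4))"
    and tame: "tame K N g P" and bd: "bounded (g ` P)"
    and B: "(\<Sum>u\<in>N. norm u) \<le> B" and K: "0 \<le> K" "K * B \<le> 1/48"
    and pq: "p \<in> P" "q \<in> P" "p \<le> q"
  shows "dist (g q) (g p) / 16 \<le> past_width N g P q - past_width N g P p"
proof -
  let ?Y = "g ` (P \<inter> {..p})"
  note near = tame_dist_le[OF tame bd B K]
  have bdY: "bounded ?Y" by (rule bounded_subset[OF bd]) auto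
  have "width N ?Y + (dist (g q) (g p) / 4) / 4 \<le> width N (insert (g q) ?Y)"
  proof (rule width_insert_growth[OF N])
    show "?Y \<noteq> {}" using pq by auto
    show "dist (g q) (g p) / 4 \<le> dist (g q) y" if "y \<in> ?Y" for y
    proof -
      obtain r where r: "r \<in> P" "r \<le> p" "y = g r" using \<open>y \<in> ?Y\<close> by auto
      show ?thesis using near[OF r(1) pq(1,2) r(2) pq(3)] dist_triangle[of "g q" "g p" "g r"]
          zero_le_dist[of "g q" "g r"] dist_commute[of "g r" "g p"] unfolding r(3) by linarith
    qed
    have *: "(g q - g r) \<bullet> (g q - g r') \<ge> - (1/12) * (dist (g q) (g r) * dist (g q) (g r'))"
      if "r \<in> P" "r' \<in> P" "r \<le> r'" "r' \<le> p" for r r'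
    proof (rule inner_ge_of_dist_le)
      show "dist (g r) (g r') \<le> dist (g q) (g r) + dist (g q) (g r') / 12"
        using near[OF that(1,2) pq(2) that(3)] that pq zero_le_dist[of "g q" "g r'"]
          dist_commute[of "g r" "g r'"] by linarith
    qed
    show "(g q - y) \<bullet> (g q - z) \<ge> - (1/12) * (dist (g q) y * dist (g q) z)"
      if "y \<in> ?Y" "z \<in> ?Y" for y z
    proof -
      obtain r r' where r: "r \<in> P" "r \<le> p" "y = g r" "r' \<in> P" "r' \<le> p" "z = g r'"
        using \<open>y \<in> ?Y\<close> \<open>z \<in> ?Y\<close> by auto
      show ?thesis
        using *[OF r(1,4) _ r(5)] *[OF r(4,1) _ r(2)] unfolding r(3,6)
        by (cases "r \<le> r'") (auto simp: inner_commute mult.commute)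
    qed
  qed (use bdY in auto)
  also have "width N (insert (g q) ?Y) \<le> width N (g ` (P \<inter> {..q}))"
  proof (rule width_mono)
    show "bounded (g ` (P \<inter> {..q}))" by (rule bounded_subset[OF bd]) auto
  qed (use pq in auto)
  finally show ?thesis by (simp add: past_width_def)
qed

text \<open>The choice \<open>K = 16 * \<epsilon>\<close> closes the argument: a step of length \<open>d\<close> brings earlier points
  closer by at most \<open>\<epsilon> * d\<close>, while tameness of the past makes the width grow by at least \<open>d / 16\<close>.\<close>

lemma tame_insert_forward:
  assumes N: "finite N" "sphere 0 1 \<subseteq> (\<Union>u\<in>N. ball u (1/4))"
    and tame: "tame K N g P" and bd: "bounded (g ` P)"
    and B: "(\<Sum>u\<in>N. norm u) \<le> B" and K: "K * B \<le> 1/48"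
    and eps: "0 \<le> \<epsilon>" "\<epsilon> \<le> 1/768" "K = 16 * \<epsilon>"
    and t: "t \<in> P" "\<And>p. p \<in> P \<Longrightarrow> p \<le> t" "t < t'"
    and fwd: "\<And>r. r \<in> P \<Longrightarrow>
      (g t' - g t) \<bullet> (g t - g r) \<ge> - \<epsilon> * (dist (g t') (g t) * dist (g t) (g r))"
  shows "tame K N g (insert t' P)"
proof -
  have K0: "0 \<le> K" using eps by simp
  let ?P = "insert t' P"
  define d where "d = dist (g t') (g t)"
  have d0: "0 \<le> d" by (simp add: d_def)
  note near = tame_dist_le[OF tame bd B K0 K]
  have exp: "(dist (g t') (g r))\<^sup>2 \<ge> (dist (g t) (g r))\<^sup>2 + d\<^sup>2 - 2 * \<epsilon> * d * dist (g t) (g r)"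
    if "r \<in> P" for r
  proof -
    have "(dist (g t') (g r))\<^sup>2 = (dist (g t) (g r))\<^sup>2 + d\<^sup>2 + 2 * ((g t' - g t) \<bullet> (g t - g r))"
      unfolding d_def dist_norm power2_norm_eq_inner by (simp add: inner_diff inner_commute algebra_simps)
    then show ?thesis using fwd[OF that] unfolding d_def by (simp add: algebra_simps)
  qed
  \<comment> \<open>Completing the square in \<open>exp\<close>: as
    \<open>\<epsilon> \<le> 1\<close>, the term \<open>d\<^sup>2\<close> dominates
    \<open>\<epsilon>\<^sup>2 * d\<^sup>2\<close>.\<close>
  have loss: "dist (g t) (g r) \<le> dist (g t') (g r) + \<epsilon> * d" if "r \<in> P" for r
  proof -
    have "\<epsilon>\<^sup>2 * d\<^sup>2 \<le> 1 * d\<^sup>2" using eps by (intro mult_right_mono power_le_one) auto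
    then have "(dist (g t) (g r) - \<epsilon> * d)\<^sup>2 \<le> (dist (g t') (g r))\<^sup>2"
      using exp[OF that] by (simp add: power2_eq_square algebra_simps)
    then have "dist (g t) (g r) - \<epsilon> * d \<le> dist (g t') (g r)" by (rule power2_le_imp_le) simp
    then show ?thesis by simp
  qed
  \<comment> \<open>The inequality of arithmetic and geometric means absorbs the mixed term of
    \<open>exp\<close>, so the new point stays at a distance comparable to \<open>d\<close> from the
    whole past.\<close>
  have far: "d \<le> 2 * dist (g t') (g r)" if "r \<in> P" for r
  proof -
    let ?f = "dist (g t) (g r)"
    have "2 * \<epsilon> * d * ?f \<le> 2 * (1/768) * d * ?f" using eps d0 by (intro mult_right_mono mult_left_mono) auto
    also have "2 * (1/768) * d * ?f \<le> (1/768) * (d\<^sup>2 + ?f\<^sup>2)"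
      using zero_le_power2[of "d - ?f"] by (simp add: power2_eq_square algebra_simps)
    finally have "d\<^sup>2 / 4 \<le> (dist (g t') (g r))\<^sup>2"
      using exp[OF that] zero_le_power2[of ?f] zero_le_power2[of d] by argo
    then have "(d / 2)\<^sup>2 \<le> (dist (g t') (g r))\<^sup>2" by (simp add: power_divide)
    then have "d / 2 \<le> dist (g t') (g r)" by (rule power2_le_imp_le) simp
    then show ?thesis by simp
  qed
  have Pt: "P \<inter> {..t} = P" using t by auto
  have grow: "width N (g ` P) + (d / 4) / 4 \<le> width N (insert (g t') (g ` P))"
  proof (rule width_insert_growth[OF N])
    show "g ` P \<noteq> {}" using t by auto
    show "d / 4 \<le> dist (g t') y" if "y \<in> g ` P" for y
      using that far d0 by fastforce
    have *: "(g t' - g r) \<bullet> (g t' - g r') \<ge> - (1/12) * (dist (g t') (g r) * dist (g t') (g r'))"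
      if rr: "r \<in> P" "r' \<in> P" "r \<le> r'" for r r'
    proof (rule inner_ge_of_dist_le)
      \<comment> \<open>\<open>near\<close> gives the factor 1/24 for the old endpoint
        \<open>t\<close>. Passing to \<open>t'\<close> costs multiples of
        \<open>\<epsilon> * d\<close>, which \<open>far\<close> converts into multiples of
        \<open>dist (g t') (g r')\<close> small enough to fit between 1/24 and 1/12.\<close>
      have "\<epsilon> * d \<le> (1/768) * d" using eps d0 by (intro mult_right_mono) auto
      then show "dist (g r) (g r') \<le> dist (g t') (g r) + dist (g t') (g r') / 12"
        using near[OF rr(1,2) t(1) rr(3) t(2)[OF rr(2)]] loss[OF rr(1)] loss[OF rr(2)] far[OF rr(2)]
          d0 zero_le_dist[of "g t'" "g r'"] dist_commute[of "g r" "g r'"] by linarith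
    qed
    show "(g t' - y) \<bullet> (g t' - z) \<ge> - (1/12) * (dist (g t') y * dist (g t') z)"
      if "y \<in> g ` P" "z \<in> g ` P" for y z
    proof -
      obtain r r' where r: "r \<in> P" "y = g r" "r' \<in> P" "z = g r'"
        using \<open>y \<in> g ` P\<close> \<open>z \<in> g ` P\<close> by auto
      show ?thesis
        using *[OF r(1,3)] *[OF r(3,1)] unfolding r(2,4)
        by (cases "r \<le> r'") (auto simp: inner_commute mult.commute)
    qed
  qed (use bd d0 in auto)
  have old: "past_width N g ?P p = past_width N g P p" if "p \<in> P" for p
  proof -
    have "?P \<inter> {..p} = P \<inter> {..p}" using t(2)[OF that] t(3) by auto
    then show ?thesis by (simp add: past_width_def)
  qed
  have "past_width N g P t = width N (g ` P)" by (simp add: past_width_def Pt)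
  moreover have "?P \<inter> {..t'} = ?P" using t by force
  then have "past_width N g ?P t' = width N (insert (g t') (g ` P))" by (simp add: past_width_def)
  ultimately have step: "d / 16 \<le> past_width N g ?P t' - past_width N g P t" using grow by simp
  show ?thesis
    unfolding tame_def
  proof (intro ballI impI)
    fix r p q assume rpq: "r \<in> ?P" "p \<in> ?P" "q \<in> ?P" "r \<le> p" "p \<le> q"
    consider "p = t'" "q = t'" | "p \<in> P" "q = t'" "r \<in> P" | "p \<in> P" "q \<in> P" "r \<in> P"
      using rpq t by fastforce
    then show "dist (g p) (g r) \<le> dist (g q) (g r) + K * (past_width N g ?P q - past_width N g ?P p)"
    proof cases
      case 2
      have "dist (g p) (g r) \<le> dist (g t) (g r) + K * (past_width N g P t - past_width N g P p)"
        using tame 2 t rpq unfolding tame_def by auto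
      moreover have "K * (d / 16) \<le> K * (past_width N g ?P t' - past_width N g P t)"
        using step K0 by (rule mult_left_mono)
      moreover have "K * (d / 16) = \<epsilon> * d" using eps by simp
      ultimately show ?thesis using loss[OF 2(3)] unfolding old[OF 2(1)] 2(2) right_diff_distrib by linarith
    next
      case 3
      then show ?thesis using tame rpq old unfolding tame_def by auto
    qed simp
  qed
qed

text \<open>Points \<open>s n\<close> of \<open>P\<close> tending to \<open>Sup P\<close> satisfy
  the condition in place of \<open>q\<close>. By monotonicity their width growth is at most the
  growth up to the supremum, and continuity of \<open>g\<close> takes the distances to the
  limit.\<close>

lemma tame_insert_Sup:
  assumes tame: "tame K N g P" and K0: "0 \<le> K"
    and cont: "continuous_on {c..d} g" and P: "P \<subseteq> {c..d}" "P \<noteq> {}"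
  shows "tame K N g (insert (Sup P) P)"
proof (cases "Sup P \<in> P")
  case True
  then show ?thesis using tame by (simp add: insert_absorb)
next
  case False
  let ?t = "Sup P" and ?P = "insert (Sup P) P"
  have bda: "bdd_above P" using P by (meson bdd_above_Icc bdd_above_mono)
  have le: "p < ?t" if "p \<in> P" for p using cSup_upper[OF that bda] False that by (cases "p = ?t") auto
  have tcd: "?t \<in> {c..d}"
    using P le by (force intro!: cSup_least)
  have Pcd: "?P \<subseteq> {c..d}" using P tcd by auto
  have "bounded (g ` {c..d})" using cont by (intro compact_imp_bounded compact_continuous_image) auto
  then have bd: "bounded (g ` ?P)" by (rule bounded_subset) (use Pcd in auto)
  have old: "past_width N g ?P p = past_width N g P p" if "p \<in> P" for p
  proof -
    have "?P \<inter> {..p} = P \<inter> {..p}" using le[OF that] by auto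
    then show ?thesis by (simp add: past_width_def)
  qed
  have "?t \<in> closure P" using P(2) bda by (rule closure_contains_Sup)
  then obtain s where s: "\<And>n. s n \<in> P" "s \<longlonglongrightarrow> ?t" unfolding closure_sequential by auto
  have gs: "(\<lambda>n. g (s n)) \<longlonglongrightarrow> g ?t"
    using s(1) P(1) by (intro continuous_on_tendsto_compose[OF cont s(2) tcd] always_eventually) blast
  show ?thesis
    unfolding tame_def
  proof (intro ballI impI)
    fix r p q assume rpq: "r \<in> ?P" "p \<in> ?P" "q \<in> ?P" "r \<le> p" "p \<le> q"
    consider "p = ?t" "q = ?t" | "p \<in> P" "q = ?t" "r \<in> P" | "p \<in> P" "q \<in> P" "r \<in> P"
      using rpq le by fastforce
    then show "dist (g p) (g r) \<le> dist (g q) (g r) + K * (past_width N g ?P q - past_width N g ?P p)"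
    proof cases
      case 2
      have "\<forall>\<^sub>F n in sequentially. p < s n"
        using order_tendstoD(1)[OF s(2) le[OF 2(1)]] .
      then have ev: "\<forall>\<^sub>F n in sequentially. dist (g p) (g r) - K * (past_width N g ?P ?t - past_width N g ?P p)
           \<le> dist (g (s n)) (g r)"
      proof eventually_elim
        case (elim n)
        have "dist (g p) (g r) \<le> dist (g (s n)) (g r) + K * (past_width N g P (s n) - past_width N g P p)"
          using tame 2 rpq s(1) elim unfolding tame_def by auto
        also have "K * (past_width N g P (s n) - past_width N g P p) \<le>
            K * (past_width N g ?P ?t - past_width N g ?P p)"
          using past_width_mono[OF bd, of "s n" ?t N] s(1)[of n] le[of "s n"] K0 old[OF s(1)] old[OF 2(1)]
          by (intro mult_left_mono) auto
        finally show ?case by simp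
      qed
      have "(\<lambda>n. dist (g (s n)) (g r)) \<longlonglongrightarrow> dist (g ?t) (g r)"
        by (intro tendsto_dist gs tendsto_const)
      from tendsto_lowerbound[OF this ev] show ?thesis using 2 by simp
    next
      case 3
      then show ?thesis using tame rpq old unfolding tame_def by auto
    qed simp
  qed
qed

section \<open>Tame sets joining the endpoints of an interval\<close>

definition end_extension :: "real set \<Rightarrow> real set \<Rightarrow> bool" where
  "end_extension P P' \<longleftrightarrow> P \<subseteq> P' \<and> (\<forall>x\<in>P' - P. \<forall>y\<in>P. y < x)"

lemma end_extension_initial:
  assumes "end_extension P P'" "p \<in> P"
  shows "P' \<inter> {..p} = P \<inter> {..p}"
proof -
  have "x \<in> P" if "x \<in> P'" "x \<le> p" for x
    using assms that unfolding end_extension_def by (metis DiffI not_less)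
  moreover have "P \<subseteq> P'" using assms(1) by (simp add: end_extension_def)
  ultimately show ?thesis by blast
qed

lemma partial_order_end_extension: "partial_order_on A (relation_of end_extension A)"
proof (rule partial_order_on_relation_ofI)
  show "end_extension P R" if "end_extension P Q" "end_extension Q R" for P Q R
    using that unfolding end_extension_def by blast
qed (auto simp: end_extension_def)

text \<open>A member of the chain containing the last parameter \<open>q\<close> of a triple
  contains every earlier point of the union, with the same past widths; so each instance of tameness
  is already one inside a single member.\<close>

lemma tame_chain_Union:
  assumes chain: "\<And>P P'. P \<in> C \<Longrightarrow> P' \<in> C \<Longrightarrow> end_extension P P' \<or> end_extension P' P"
    and tame: "\<And>P. P \<in> C \<Longrightarrow> tame K N g P"
  shows "tame K N g (\<Union>C)" and "\<And>P. P \<in> C \<Longrightarrow> end_extension P (\<Union>C)"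
proof -
  show ext: "end_extension P (\<Union>C)" if P: "P \<in> C" for P
    using chain[OF P] P unfolding end_extension_def by blast
  show "tame K N g (\<Union>C)"
    unfolding tame_def
  proof (intro ballI impI)
    fix r p q assume rpq: "r \<in> \<Union>C" "p \<in> \<Union>C" "q \<in> \<Union>C" "r \<le> p" "p \<le> q"
    then obtain P where P: "P \<in> C" "q \<in> P" by blast
    have down: "x \<in> P" if "x \<in> \<Union>C" "x \<le> q" for x
      using end_extension_initial[OF ext[OF P(1)] P(2)] that by blast
    have w: "past_width N g (\<Union>C) x = past_width N g P x" if "x \<in> P" for x
      unfolding past_width_def using end_extension_initial[OF ext[OF P(1)] that] by simp
    have "r \<in> P" "p \<in> P" using down rpq by auto
    then show "dist (g p) (g r) \<le> dist (g q) (g r) + K * (past_width N g (\<Union>C) q - past_width N g (\<Union>C) p)"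
      using tame[OF P(1)] P rpq(4,5) w unfolding tame_def by auto
  qed
qed

text \<open>The angle at \<open>g t\<close> between the earlier point \<open>g r\<close> and the
  next point \<open>g t'\<close> has cosine at most \<open>\<epsilon>\<close>, written without
  division so that points may coincide. The admissible step \<open>\<tau>\<close> depends on
  \<open>t\<close> but not on \<open>r\<close>.\<close>

definition forward_obtuse :: "real \<Rightarrow> (real \<Rightarrow> real^2) \<Rightarrow> real \<Rightarrow> real \<Rightarrow> bool" where
  "forward_obtuse \<epsilon> g c d \<longleftrightarrow>
     (\<forall>t\<in>{c..<d}. \<exists>\<tau>>0. \<forall>t'\<in>{c..d}. t < t' \<longrightarrow> t' < t + \<tau> \<longrightarrow> (\<forall>r\<in>{c..t}.
        (g t' - g t) \<bullet> (g t - g r) \<ge> - \<epsilon> * (dist (g t') (g t) * dist (g t) (g r))))"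

text \<open>Zorn's lemma is applied to end extensions rather than inclusion, because
  \<^const>\<open>past_width\<close> at an old point must not change. Prescribing the finite set \<open>Q\<close> makes the
  nodes of a given partition part of \<open>P\<close>.\<close>

lemma tame_set_exists:
  assumes N: "finite N" "sphere 0 1 \<subseteq> (\<Union>u\<in>N. ball u (1/4))"
    and B: "(\<Sum>u\<in>N. norm u) \<le> B" and K: "K * B \<le> 1/48"
    and eps: "0 \<le> \<epsilon>" "\<epsilon> \<le> 1/768" "K = 16 * \<epsilon>"
    and cd: "c \<le> d" and cont: "continuous_on {c..d} g"
    and fwd: "forward_obtuse \<epsilon> g c d"
    and Q: "finite Q" "Q \<subseteq> {c..d}"
  shows "\<exists>P. c \<in> P \<and> d \<in> P \<and> Q \<subseteq> P \<and> P \<subseteq> {c..d} \<and> tame K N g P"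
proof -
  \<comment> \<open>The witness \<open>m\<close> is the largest element of \<open>P\<close>, and all
    of \<open>Q\<close> up to \<open>m\<close> has been collected; once \<open>m = d\<close>, this
    gives \<open>Q \<subseteq> P\<close>.\<close>
  define A where "A = {P. c \<in> P \<and> P \<subseteq> {c..d} \<and> tame K N g P \<and> (\<exists>m\<in>P. P \<subseteq> {..m} \<and> Q \<inter> {..m} \<subseteq> P)}"
  have K0: "0 \<le> K" using eps by simp
  have bd: "bounded (g ` P)" if "P \<subseteq> {c..d}" for P
  proof -
    have "bounded (g ` {c..d})" using cont by (intro compact_imp_bounded compact_continuous_image) auto
    then show ?thesis by (rule bounded_subset) (use that in auto)
  qed
  have "\<exists>M\<in>A. \<forall>P\<in>A. end_extension M P \<longrightarrow> P = M"
  proof (rule predicate_Zorn[OF partial_order_end_extension])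
    fix C assume C: "C \<in> Chains (relation_of end_extension A)"
    then have CA: "C \<subseteq> A" and chain: "\<And>P P'. P \<in> C \<Longrightarrow> P' \<in> C \<Longrightarrow> end_extension P P' \<or> end_extension P' P"
      unfolding Chains_def relation_of_def by auto
    show "\<exists>u\<in>A. \<forall>P\<in>C. end_extension P u"
    proof (cases "C = {}")
      case True
      have "{c} \<in> A" using Q cd by (auto simp: A_def tame_def)
      then show ?thesis using True by blast
    next
      case False
      let ?U = "\<Union>C" and ?t = "Sup (\<Union>C)"
      have Utame: "tame K N g ?U" and ext: "\<And>P. P \<in> C \<Longrightarrow> end_extension P ?U"
        using tame_chain_Union[OF chain, of C K N g] CA by (auto simp: A_def)
      have U: "?U \<subseteq> {c..d}" "c \<in> ?U" using CA False by (auto simp: A_def)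
      have bda: "bdd_above ?U" using U(1) by (meson bdd_above_Icc bdd_above_mono)
      have le: "p \<le> ?t" if "p \<in> ?U" for p using that bda by (rule cSup_upper)
      have td: "?t \<in> {c..d}" using U le[OF U(2)] by (auto intro!: cSup_least)
      \<comment> \<open>The union of a chain may lack the largest element that \<open>A\<close>
        demands; its supremum is added.\<close>
      have "insert ?t ?U \<in> A"
        unfolding A_def
      proof (intro CollectI conjI bexI[of _ ?t])
        show "tame K N g (insert ?t ?U)"
          using tame_insert_Sup[OF Utame K0 cont U(1)] U(2) by blast
        show "Q \<inter> {..?t} \<subseteq> insert ?t ?U"
        proof
          fix q assume q: "q \<in> Q \<inter> {..?t}"
          show "q \<in> insert ?t ?U"
          proof (cases "q = ?t")
            case False
            then have "q < ?t" using q by auto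
            then obtain p where p: "p \<in> ?U" "q < p" using less_cSup_iff[OF _ bda] U(2) by blast
            then obtain P where P: "P \<in> C" "p \<in> P" by blast
            then obtain m where m: "m \<in> P" "P \<subseteq> {..m}" "Q \<inter> {..m} \<subseteq> P"
              using CA unfolding A_def by blast
            have "q \<le> m" using m(2) P(2) p(2) by force
            then have "q \<in> P" using m(3) q by blast
            then show ?thesis using P by blast
          qed simp
        qed
      qed (use U td le in auto)
      moreover have "end_extension P (insert ?t ?U)" if "P \<in> C" for P
        using ext[OF that] le that unfolding end_extension_def by fastforce
      ultimately show ?thesis by blast
    qed
  qed
  then obtain M where M: "M \<in> A" and max: "\<And>P. P \<in> A \<Longrightarrow> end_extension M P \<Longrightarrow> P = M" by blast
  from M obtain m where m: "c \<in> M" "M \<subseteq> {c..d}" "tame K N g M" "m \<in> M" "M \<subseteq> {..m}" "Q \<inter> {..m} \<subseteq> M"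
    unfolding A_def by blast
  have "m = d"
  proof (rule ccontr)
    assume "m \<noteq> d"
    then have mcd: "m \<in> {c..<d}" using m by force
    then obtain \<tau> where \<tau>: "\<tau> > 0" "\<And>t' r. t' \<in> {c..d} \<Longrightarrow> m < t' \<Longrightarrow> t' < m + \<tau> \<Longrightarrow> r \<in> {c..m} \<Longrightarrow>
      (g t' - g m) \<bullet> (g m - g r) \<ge> - \<epsilon> * (dist (g t') (g m) * dist (g m) (g r))"
      using fwd mcd unfolding forward_obtuse_def by blast
    \<comment> \<open>The next parameter is the first among \<open>d\<close>, a point within reach
      of \<open>\<tau>\<close>, and the elements of \<open>Q\<close> after \<open>m\<close>, so no
      prescribed point is skipped.\<close>
    define F where "F = insert d (insert (m + \<tau> / 2) {q \<in> Q. m < q})"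
    have md: "m < d" using mcd by simp
    have F: "finite F" "F \<noteq> {}" using Q(1) by (simp_all add: F_def)
    have Fm: "m < x" if "x \<in> F" for x
      using that md \<tau>(1) unfolding F_def by auto
    define t where "t = Min F"
    have t: "m < t" "t \<le> d" "t \<le> m + \<tau> / 2" "\<And>q. q \<in> Q \<Longrightarrow> m < q \<Longrightarrow> t \<le> q"
    proof -
      show "m < t" unfolding t_def using F by (intro Fm Min_in)
      have le: "t \<le> x" if "x \<in> F" for x unfolding t_def using F(1) that by (rule Min_le)
      show "t \<le> d" "t \<le> m + \<tau> / 2" by (auto intro!: le simp: F_def)
      show "t \<le> q" if "q \<in> Q" "m < q" for q using that by (intro le) (simp add: F_def)
    qed
    have tcd: "t \<in> {c..d}" using t mcd by auto
    have Mm: "p \<le> m" if "p \<in> M" for p using m(5) that by auto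
    have "insert t M \<in> A"
      unfolding A_def
    proof (intro CollectI conjI bexI[of _ t])
      show "tame K N g (insert t M)"
      proof (rule tame_insert_forward[OF N m(3) bd[OF m(2)] B K eps m(4) Mm t(1)])
        fix r assume "r \<in> M"
        then show "(g t - g m) \<bullet> (g m - g r) \<ge> - \<epsilon> * (dist (g t) (g m) * dist (g m) (g r))"
          using \<tau>(1) t(1,3) tcd m(2) Mm[of r] by (intro \<tau>(2)) auto
      qed
      show "insert t M \<subseteq> {..t}" using m(5) t(1) by auto
      show "Q \<inter> {..t} \<subseteq> insert t M" using m(6) t(4)
      proof -
        have "q \<le> m \<or> q = t" if "q \<in> Q" "q \<le> t" for q using t(4)[OF that(1)] that(2) by linarith
        then show ?thesis using m(6) by blast
      qed
    qed (use m tcd in auto)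
    moreover have "end_extension M (insert t M)" using Mm t(1) unfolding end_extension_def by fastforce
    ultimately have "insert t M = M" using max by blast
    then show False using Mm[of t] t by auto
  qed
  have "Q \<subseteq> {..d}" using Q(2) by auto
  then have "Q \<subseteq> M" using m(6) \<open>m = d\<close> by blast
  then show ?thesis using m \<open>m = d\<close> by blast
qed

lemma finite_net_sphere:
  obtains N :: "(real^2) set" where "finite N" "sphere 0 1 \<subseteq> (\<Union>u\<in>N. ball u (1/4))"
proof (rule compactE_image[of "sphere (0::real^2) 1" "sphere 0 1" "\<lambda>u. ball u (1/4)"])
  show "sphere (0::real^2) 1 \<subseteq> (\<Union>u\<in>sphere 0 1. ball u (1/4))" by force
qed (use that in auto)

text \<open>The nodes of an inscribed polygon are placed in a tame set \<open>P\<close>. Each edge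
  is at most 16 times the growth of the past width, the sum telescopes, and the total growth is at
  most \<open>D * B\<close> because the past of \<open>c\<close> in \<open>P\<close> is the single
  point \<open>g c\<close>. Both constants depend only on the net.\<close>

lemma inscribed_length_le:
  "\<exists>\<epsilon>>0. \<exists>C\<ge>0. \<forall>(g :: real \<Rightarrow> real^2) c d D S. c \<le> d \<longrightarrow> continuous_on {c..d} g \<longrightarrow>
     forward_obtuse \<epsilon> g c d \<longrightarrow> (\<forall>t\<in>{c..d}. dist (g t) (g c) \<le> D) \<longrightarrow>
     S \<in> inscribed_lengths g c d \<longrightarrow> S \<le> C * D"
proof -
  obtain N :: "(real^2) set" where N: "finite N" "sphere 0 1 \<subseteq> (\<Union>u\<in>N. ball u (1/4))"
    by (rule finite_net_sphere)
  \<comment> \<open>The summand 1 ensures \<open>B \<ge> 1\<close>, hence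
    \<open>\<epsilon> \<le> 1/768\<close>; and \<open>K * B\<close> equals 16/768 = 1/48.\<close>
  define B where "B = 1 + (\<Sum>u\<in>N. norm u)"
  have B: "(\<Sum>u\<in>N. norm u) \<le> B" "B \<ge> 1" by (auto simp: B_def sum_nonneg)
  define \<epsilon> where "\<epsilon> = 1 / (768 * B)"
  define K where "K = 16 * \<epsilon>"
  have eps: "\<epsilon> > 0" "\<epsilon> \<le> 1/768" using B by (auto simp: \<epsilon>_def field_simps)
  have K: "K * B \<le> 1/48" using B by (simp add: K_def \<epsilon>_def)
  show ?thesis
  proof (rule exI[of _ \<epsilon>], rule conjI[OF eps(1)], rule exI[of _ "16 * B"], intro conjI allI impI)
    fix g :: "real \<Rightarrow> real^2" and c d D S :: real
    assume cd: "c \<le> d" and cont: "continuous_on {c..d} g" and fwd: "forward_obtuse \<epsilon> g c d"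
      and D: "\<forall>t\<in>{c..d}. dist (g t) (g c) \<le> D"
      and S: "S \<in> inscribed_lengths g c d"
    obtain n p where p: "mono_on {..n::nat} p" "p 0 = c" "p n = d"
      "S = (\<Sum>i<n. dist (g (p i)) (g (p (Suc i))))"
      using S unfolding inscribed_lengths_def by blast
    have pcd: "p ` {..n} \<subseteq> {c..d}" using monotone_onD[OF p(1)] p(2,3) by fastforce
    obtain P where P: "c \<in> P" "d \<in> P" "p ` {..n} \<subseteq> P" "P \<subseteq> {c..d}" "tame K N g P"
      using tame_set_exists[OF N B(1) K _ eps(2) K_def cd cont fwd _ pcd] eps(1) by auto
    have "bounded (g ` {c..d})" using cont by (intro compact_imp_bounded compact_continuous_image) auto
    then have bd: "bounded (g ` P)" by (rule bounded_subset) (use P in auto)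
    let ?w = "past_width N g P"
    have "S \<le> (\<Sum>i<n. 16 * (?w (p (Suc i)) - ?w (p i)))"
      unfolding p(4)
    proof (rule sum_mono)
      fix i assume i: "i \<in> {..<n}"
      have "p i \<in> P" "p (Suc i) \<in> P" using P(3) i by auto
      moreover have "p i \<le> p (Suc i)" using monotone_onD[OF p(1)] i by auto
      ultimately show "dist (g (p i)) (g (p (Suc i))) \<le> 16 * (?w (p (Suc i)) - ?w (p i))"
        using tame_past_width_ge[OF N P(5) bd B(1) _ K, of "p i" "p (Suc i)"] eps(1) 
        by (simp add: K_def dist_commute)
    qed
    also have "\<dots> = 16 * (\<Sum>i<n. ?w (p (Suc i)) - ?w (p i))" by (simp only: sum_distrib_left)
    also have "(\<Sum>i<n. ?w (p (Suc i)) - ?w (p i)) = ?w d - ?w c"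
      using sum_lessThan_telescope[of "\<lambda>i. ?w (p i)" n] p(2,3) by simp
    also have "16 * (?w d - ?w c) \<le> 16 * (D * B)"
    proof -
      have D0: "0 \<le> D" using bspec[OF D, of c] cd by simp
      have "?w d \<le> ?w c + D * (\<Sum>u\<in>N. norm u)"
        unfolding past_width_def
      proof (rule width_le)
        show "bounded (g ` (P \<inter> {..c}))" by (rule bounded_subset[OF bd]) auto
        show "g ` (P \<inter> {..d}) \<noteq> {}" using P cd by auto
        show "\<exists>y\<in>g ` (P \<inter> {..c}). dist z y \<le> D" if "z \<in> g ` (P \<inter> {..d})" for z
          using that P D by (intro bexI[of _ "g c"]) auto
      qed
      also have "D * (\<Sum>u\<in>N. norm u) \<le> D * B" using B(1) D0 by (rule mult_left_mono)
      finally show ?thesis by simp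
    qed
    finally show "S \<le> 16 * B * D" by (simp add: mult_ac)
  qed (use B in auto)
qed

subsection \<open>Length of R-paths\<close>

text \<open>If violations occurred at parameters decreasing to \<open>t\<close>, a subsequence of
  the step directions would converge to a unit forward tangent \<open>l\<close>. The disk at
  \<open>g t + R *\<^sub>R l\<close> contains no past point, which gives
  \<open>2 * R * (l \<bullet> y) \<le> (norm y)\<^sup>2\<close> for the past vector
  \<open>y\<close>; with \<open>norm y \<le> \<epsilon> * R\<close> this costs half of
  \<open>\<epsilon>\<close>, and the error of the direction costs the other half.\<close>

lemma R_path_forward_inner:
  assumes "R > 0" "\<epsilon> > 0" and path: "R_path R a b g" and t: "t \<in> {a..<b}"
  shows "\<exists>\<tau>>0. \<forall>t'\<in>{a..b}. t < t' \<longrightarrow> t' < t + \<tau> \<longrightarrow> (\<forall>r\<in>{a..t}. dist (g t) (g r) \<le> \<epsilon> * R \<longrightarrow>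
      (g t' - g t) \<bullet> (g t - g r) \<ge> - \<epsilon> * (dist (g t') (g t) * dist (g t) (g r)))"
proof (rule ccontr)
  assume neg: "\<not> ?thesis"
  have "\<exists>t' r. t' \<in> {a..b} \<and> t < t' \<and> t' < t + 1 / Suc n \<and> r \<in> {a..t} \<and> dist (g t) (g r) \<le> \<epsilon> * R \<and>
      (g t' - g t) \<bullet> (g t - g r) < - \<epsilon> * (dist (g t') (g t) * dist (g t) (g r))" for n :: nat
  proof -
    have "1 / real (Suc n) > 0" by simp
    then show ?thesis using neg by (meson not_le)
  qed
  then obtain t' r where t': "\<And>n. t' n \<in> {a..b}" "\<And>n::nat. t < t' n" "\<And>n. t' n < t + 1 / Suc n"
    and r: "\<And>n. r n \<in> {a..t}" "\<And>n. dist (g t) (g (r n)) \<le> \<epsilon> * R"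
    and viol: "\<And>n. (g (t' n) - g t) \<bullet> (g t - g (r n)) < - \<epsilon> * (dist (g (t' n)) (g t) * dist (g t) (g (r n)))"
    by metis
  have cont: "continuous_on {a..b} g" using path by (simp add: R_path_def)
  define e where "e n = (g (t' n) - g t) /\<^sub>R dist (g (t' n)) (g t)" for n
  \<comment> \<open>With \<open>g (t' n) = g t\<close> the violation would read 0 < 0, so the
    directions \<open>e n\<close> are unit vectors.\<close>
  have d0: "dist (g (t' n)) (g t) > 0" for n
    using viol[of n] by (cases "g (t' n) = g t") auto
  have "e n \<in> sphere 0 1" for n using d0[of n] by (simp add: e_def dist_norm)
  then obtain l \<sigma> where l: "l \<in> sphere 0 1" "strict_mono (\<sigma> :: nat \<Rightarrow> nat)" "(e \<circ> \<sigma>) \<longlonglongrightarrow> l"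
    using compact_sphere[of "0::real^2" 1] unfolding compact_def by metis
  have "t' \<longlonglongrightarrow> t"
  proof (rule tendsto_sandwich[of "\<lambda>_. t" t' sequentially "\<lambda>n. t + 1 / real (Suc n)"])
    show "(\<lambda>n. t + 1 / real (Suc n)) \<longlonglongrightarrow> t"
      using tendsto_add[OF tendsto_const[of t] lim_1_over_n[THEN LIMSEQ_Suc]] by simp
  qed (use t' in \<open>auto intro!: always_eventually less_imp_le simp del: of_nat_Suc\<close>)
  then have "(\<lambda>n. t' (\<sigma> n)) \<longlonglongrightarrow> t" using l(2) by (rule LIMSEQ_subseq_LIMSEQ[unfolded comp_def])
  then have gt: "(\<lambda>n. g (t' (\<sigma> n))) \<longlonglongrightarrow> g t"
    using t t'(1) by (intro continuous_on_tendsto_compose[OF cont] always_eventually allI) auto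
  have near: "\<exists>n. dist (g (t' (\<sigma> n))) (g t) < \<kappa> \<and> dist (e (\<sigma> n)) l < \<kappa>" if "\<kappa> > 0" for \<kappa>
  proof -
    have "\<forall>\<^sub>F n in sequentially. dist (g (t' (\<sigma> n))) (g t) < \<kappa> \<and> dist (e (\<sigma> n)) l < \<kappa>"
      using tendstoD[OF gt that] tendstoD[OF l(3) that] by (simp add: eventually_conj)
    then show ?thesis by (rule eventually_happens'[OF sequentially_bot])
  qed
  have "l \<in> tangent_cone (g ` {t..b}) (g t)"
    unfolding tangent_cone_def
  proof (intro CollectI allI impI)
    fix \<kappa> :: real assume "\<kappa> > 0"
    then obtain n where n: "dist (g (t' (\<sigma> n))) (g t) < \<kappa>" "dist (e (\<sigma> n)) l < \<kappa>" using near by blast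
    show "\<exists>x\<in>g ` {t..b}. \<exists>r>0. norm (x - g t) < \<kappa> \<and> norm (r *\<^sub>R (x - g t) - l) < \<kappa>"
    proof (intro bexI exI conjI)
      show "inverse (dist (g (t' (\<sigma> n))) (g t)) > 0" using d0 by simp
      show "norm (g (t' (\<sigma> n)) - g t) < \<kappa>" using n(1) by (simp add: dist_norm)
      show "norm (inverse (dist (g (t' (\<sigma> n))) (g t)) *\<^sub>R (g (t' (\<sigma> n)) - g t) - l) < \<kappa>"
        using n(2) by (simp add: dist_norm e_def)
      show "g (t' (\<sigma> n)) \<in> g ` {t..b}" using t'(1,2)[of "\<sigma> n"] by auto
    qed
  qed
  then have free: "g ` {a..t} \<inter> ball (g t + R *\<^sub>R l) R = {}"
    using path t l(1) unfolding R_path_def by auto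
  obtain n where n: "dist (e (\<sigma> n)) l < \<epsilon> / 2" using near[of "\<epsilon> / 2"] assms(2) by auto
  define y where "y = g (r (\<sigma> n)) - g t"
  have y: "norm y \<le> \<epsilon> * R" using r(2)[of "\<sigma> n"] by (simp add: y_def dist_norm norm_minus_commute)
  have "g (r (\<sigma> n)) \<notin> ball (g t + R *\<^sub>R l) R" using free r(1) by blast
  then have "R \<le> norm (y - R *\<^sub>R l)" by (simp add: y_def dist_norm norm_minus_commute algebra_simps)
  then have "R\<^sup>2 \<le> (norm (y - R *\<^sub>R l))\<^sup>2" using assms(1) by (intro power_mono) auto
  also have "\<dots> = (norm y)\<^sup>2 - 2 * R * (l \<bullet> y) + R\<^sup>2 * (l \<bullet> l)"
    unfolding power2_norm_eq_inner by (simp add: inner_diff inner_commute algebra_simps power2_eq_square)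
  finally have "2 * R * (l \<bullet> y) \<le> norm y * norm y"
    using l(1) by (simp add: norm_eq_1 power2_eq_square)
  also have "\<dots> \<le> (\<epsilon> * R) * norm y" using y by (intro mult_right_mono) auto
  finally have ly: "l \<bullet> y \<le> \<epsilon> / 2 * norm y" using assms(1) by (simp add: field_simps)
  have "(e (\<sigma> n) - l) \<bullet> y \<le> norm (e (\<sigma> n) - l) * norm y" by (rule norm_cauchy_schwarz)
  also have "\<dots> \<le> \<epsilon> / 2 * norm y" using n by (intro mult_right_mono) (auto simp: dist_norm)
  finally have "e (\<sigma> n) \<bullet> y \<le> \<epsilon> * norm y" using ly by (simp add: inner_diff_left)
  moreover have "e (\<sigma> n) \<bullet> y > \<epsilon> * norm y"
  proof -
    let ?d = "dist (g (t' (\<sigma> n))) (g t)"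
    have "?d * (\<epsilon> * norm y) < (g (t' (\<sigma> n)) - g t) \<bullet> y"
      using viol[of "\<sigma> n"] by (simp add: y_def dist_norm norm_minus_commute inner_diff_right algebra_simps)
    also have "(g (t' (\<sigma> n)) - g t) \<bullet> y = ?d * (e (\<sigma> n) \<bullet> y)"
      using d0[of "\<sigma> n"] by (simp add: e_def)
    finally show ?thesis using d0[of "\<sigma> n"] by simp
  qed
  ultimately show False by simp
qed

section \<open>Inscribed polygons and arc length of adjacent pieces\<close>

lemma inscribed_lengthsI:
  "mono_on {..n} p \<Longrightarrow> p 0 = a \<Longrightarrow> p n = b \<Longrightarrow>
    (\<Sum>i<n. dist (g (p i)) (g (p (Suc i)))) \<in> inscribed_lengths g a b"
  unfolding inscribed_lengths_def by blast

lemma dist_in_inscribed_lengths: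
  assumes "s \<le> t"
  shows "dist (g s) (g t) \<in> inscribed_lengths g s t"
  unfolding inscribed_lengths_def
  by (rule CollectI, rule exI[of _ 1], rule exI[of _ "\<lambda>i. if i = 0 then s else t"])
     (use assms in \<open>auto simp: monotone_on_def\<close>)

lemma inscribed_lengths_append:
  assumes "S \<in> inscribed_lengths g a s" "s \<le> t"
  shows "S + dist (g s) (g t) \<in> inscribed_lengths g a t"
proof -
  obtain n p where p: "mono_on {..n::nat} p" "p 0 = a" "p n = s"
      "S = (\<Sum>i<n. dist (g (p i)) (g (p (Suc i))))"
    using assms(1) unfolding inscribed_lengths_def by blast
  define q where "q i = (if i \<le> n then p i else t)" for i
  have "p i \<le> s" if "i \<le> n" for i using monotone_onD[OF p(1), of i n] that p(3) by auto
  then have "mono_on {..Suc n} q"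
    using monotone_onD[OF p(1)] assms(2) unfolding monotone_on_def q_def by force
  moreover have "(\<Sum>i<Suc n. dist (g (q i)) (g (q (Suc i)))) = S + dist (g s) (g t)"
    using p(3,4) by (simp add: q_def)
  moreover have "q 0 = a" "q (Suc n) = t" using p by (auto simp: q_def)
  ultimately show ?thesis unfolding inscribed_lengths_def by force
qed

text \<open>Clamping all nodes with \<open>min\<close> and \<open>max\<close> at \<open>b\<close>
  yields the two partitions with the same \<open>n\<close>; repeated nodes contribute 0, and the
  triangle inequality treats an edge across \<open>b\<close>.\<close>

lemma inscribed_lengths_split:
  assumes "S \<in> inscribed_lengths g a c" "a \<le> b" "b \<le> c"
  shows "\<exists>S1\<in>inscribed_lengths g a b. \<exists>S2\<in>inscribed_lengths g b c. S \<le> S1 + S2"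
proof -
  obtain n p where p: "mono_on {..n::nat} p" "p 0 = a" "p n = c"
      "S = (\<Sum>i<n. dist (g (p i)) (g (p (Suc i))))"
    using assms(1) unfolding inscribed_lengths_def by blast
  let ?p1 = "\<lambda>i. min (p i) b" and ?p2 = "\<lambda>i. max (p i) b"
  let ?S = "\<lambda>q. (\<Sum>i<n. dist (g (q i)) (g (q (Suc i))))"
  have "mono_on {..n} ?p1" "mono_on {..n} ?p2"
    by (intro monotone_onI min.mono max.mono order_refl monotone_onD[OF p(1)]; assumption)+
  then have "?S ?p1 \<in> inscribed_lengths g a b" "?S ?p2 \<in> inscribed_lengths g b c"
    using p(2,3) assms(2,3) by (auto intro!: inscribed_lengthsI)
  moreover have "S \<le> ?S ?p1 + ?S ?p2"
    unfolding p(4) sum.distrib[symmetric]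
  proof (rule sum_mono)
    fix i assume i: "i \<in> {..<n}"
    then have "p i \<le> p (Suc i)" using monotone_onD[OF p(1)] by auto
    then show "dist (g (p i)) (g (p (Suc i))) \<le>
       dist (g (min (p i) b)) (g (min (p (Suc i)) b)) + dist (g (max (p i) b)) (g (max (p (Suc i)) b))"
      using dist_triangle[of "g (p i)" "g (p (Suc i))" "g b"] by (auto simp: min_def max_def)
  qed
  ultimately show ?thesis by blast
qed

lemma rectifiable_trans:
  assumes "rectifiable g a b" "rectifiable g b c" "a \<le> b" "b \<le> c"
  shows "rectifiable g a c"
proof -
  obtain M1 M2 where "\<And>S. S \<in> inscribed_lengths g a b \<Longrightarrow> S \<le> M1" "\<And>S. S \<in> inscribed_lengths g b c \<Longrightarrow> S \<le> M2"
    using assms(1,2) unfolding rectifiable_def bdd_above_def by blast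
  then have "S \<le> M1 + M2" if "S \<in> inscribed_lengths g a c" for S
    using inscribed_lengths_split[OF that assms(3,4)] by (meson add_mono order_trans)
  then show ?thesis unfolding rectifiable_def bdd_above_def by blast
qed

lemma rectifiable_initial:
  assumes "rectifiable g a b" "t \<le> b"
  shows "rectifiable g a t"
proof -
  obtain M where M: "\<And>S. S \<in> inscribed_lengths g a b \<Longrightarrow> S \<le> M"
    using assms(1) unfolding rectifiable_def bdd_above_def by blast
  have "S \<le> M" if "S \<in> inscribed_lengths g a t" for S
    using M[OF inscribed_lengths_append[OF that assms(2)]] zero_le_dist[of "g t" "g b"] by linarith
  then show ?thesis unfolding rectifiable_def bdd_above_def by blast
qed

lemma arc_length_upper:
  "rectifiable g a b \<Longrightarrow> S \<in> inscribed_lengths g a b \<Longrightarrow> S \<le> arc_length g a b"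
  unfolding arc_length_def rectifiable_def by (rule cSup_upper)

text \<open>The chord is appended to polygons that end at \<open>s\<close>. This yields both
  monotonicity of the arc length and the Lipschitz bound for the representation by arc
  length.\<close>

lemma arc_length_add_dist_le:
  assumes "rectifiable g a b" "a \<le> s" "s \<le> t" "t \<le> b"
  shows "arc_length g a s + dist (g s) (g t) \<le> arc_length g a t"
proof -
  have t: "rectifiable g a t" using rectifiable_initial assms by blast
  have "arc_length g a s \<le> arc_length g a t - dist (g s) (g t)"
    unfolding arc_length_def[of g a s]
  proof (rule cSup_least)
    show "inscribed_lengths g a s \<noteq> {}" using dist_in_inscribed_lengths[OF assms(2)] by blast
    show "S \<le> arc_length g a t - dist (g s) (g t)" if "S \<in> inscribed_lengths g a s" for S
      using arc_length_upper[OF t inscribed_lengths_append[OF that assms(3)]] by simp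
  qed
  then show ?thesis by simp
qed

lemma arc_length_le_add:
  assumes "rectifiable g a b" "a \<le> s" "s \<le> t" "t \<le> b"
    and M: "\<And>S. S \<in> inscribed_lengths g s t \<Longrightarrow> S \<le> M"
  shows "arc_length g a t \<le> arc_length g a s + M"
  unfolding arc_length_def[of g a t]
proof (rule cSup_least)
  show "inscribed_lengths g a t \<noteq> {}" using dist_in_inscribed_lengths[of a t g] assms by fastforce
  fix S assume "S \<in> inscribed_lengths g a t"
  then obtain S1 S2 where S: "S1 \<in> inscribed_lengths g a s" "S2 \<in> inscribed_lengths g s t" "S \<le> S1 + S2"
    using inscribed_lengths_split assms by blast
  have "rectifiable g a s" using rectifiable_initial assms by (meson order_trans)
  from arc_length_upper[OF this S(1)] M[OF S(2)] S(3)
  show "S \<le> arc_length g a s + M" by simp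
qed

section \<open>Rectifiability of R-paths and continuity of arc length\<close>

text \<open>The angle estimate holds for past points within \<open>\<epsilon> * R\<close>. A piece
  staying within \<open>\<epsilon> * R / 2\<close> of its start has all its points that close to
  each other, hence is forward obtuse with respect to its own past. The constants serve all
  pieces.\<close>

lemma R_path_inscribed_length_le:
  assumes "R > 0" and path: "R_path R a b g"
  obtains C \<delta> :: real where "C \<ge> 0" "\<delta> > 0"
    "\<And>s t D S. \<lbrakk>a \<le> s; s \<le> t; t \<le> b; \<And>u. u \<in> {s..t} \<Longrightarrow> dist (g u) (g s) \<le> D; D \<le> \<delta>;
       S \<in> inscribed_lengths g s t\<rbrakk> \<Longrightarrow> S \<le> C * D"
proof -
  obtain \<epsilon> C :: real where \<epsilon>: "\<epsilon> > 0" "C \<ge> 0" and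
    bound: "\<And>(g :: real \<Rightarrow> real^2) c d D S. c \<le> d \<Longrightarrow> continuous_on {c..d} g \<Longrightarrow>
      forward_obtuse \<epsilon> g c d \<Longrightarrow> \<forall>t\<in>{c..d}. dist (g t) (g c) \<le> D \<Longrightarrow>
      S \<in> inscribed_lengths g c d \<Longrightarrow> S \<le> C * D"
    using inscribed_length_le by metis
  show thesis
  proof (rule that[OF \<epsilon>(2), of "\<epsilon> * R / 2"])
    fix s t D S
    assume st: "a \<le> s" "s \<le> t" "t \<le> b" and D: "\<And>u. u \<in> {s..t} \<Longrightarrow> dist (g u) (g s) \<le> D"
      "D \<le> \<epsilon> * R / 2" and S: "S \<in> inscribed_lengths g s t"
    show "S \<le> C * D"
    proof (rule bound[OF st(2) _ _ _ S])
      show "continuous_on {s..t} g"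
        using path st by (auto simp: R_path_def intro: continuous_on_subset)
      show "\<forall>u\<in>{s..t}. dist (g u) (g s) \<le> D" using D(1) by blast
      show "forward_obtuse \<epsilon> g s t"
        unfolding forward_obtuse_def
      proof
        fix u assume u: "u \<in> {s..<t}"
        then have "u \<in> {a..<b}" using st by auto
        then obtain \<tau> where \<tau>: "\<tau> > 0" "\<And>u' r. u' \<in> {a..b} \<Longrightarrow> u < u' \<Longrightarrow> u' < u + \<tau> \<Longrightarrow> r \<in> {a..u} \<Longrightarrow>
            dist (g u) (g r) \<le> \<epsilon> * R \<Longrightarrow>
            (g u' - g u) \<bullet> (g u - g r) \<ge> - \<epsilon> * (dist (g u') (g u) * dist (g u) (g r))"
          using R_path_forward_inner[OF assms(1) \<epsilon>(1) path] by metis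
        have "dist (g u) (g r) \<le> \<epsilon> * R" if "r \<in> {s..u}" for r
          using dist_triangle[of "g u" "g r" "g s"] D(1)[of u] D(1)[of r] D(2) that u
            dist_commute[of "g s" "g r"] by force
        then show "\<exists>\<tau>>0. \<forall>t'\<in>{s..t}. u < t' \<longrightarrow> t' < u + \<tau> \<longrightarrow> (\<forall>r\<in>{s..u}.
          (g t' - g u) \<bullet> (g u - g r) \<ge> - \<epsilon> * (dist (g t') (g u) * dist (g u) (g r)))"
          using st by (intro exI[of _ \<tau>] conjI ballI impI \<tau>) auto
      qed
    qed
  qed (use \<epsilon> assms in auto)
qed

lemma R_path_rectifiable:
  assumes "R > 0" and path: "R_path R a b g"
  shows "rectifiable g a b"
proof -
  have ab: "a \<le> b" and cont: "continuous_on {a..b} g" using path by (auto simp: R_path_def)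
  obtain C \<delta> where C: "C \<ge> 0" "\<delta> > 0"
    "\<And>s t D S. \<lbrakk>a \<le> s; s \<le> t; t \<le> b; \<And>u. u \<in> {s..t} \<Longrightarrow> dist (g u) (g s) \<le> D; D \<le> \<delta>;
       S \<in> inscribed_lengths g s t\<rbrakk> \<Longrightarrow> S \<le> C * D"
    using R_path_inscribed_length_le[OF assms] by metis
  \<comment> \<open>Bisection reduces the claim to short intervals around each point. The premises
    \<open>a \<le> u\<close> and \<open>v \<le> b\<close> are built into the property because such
    intervals may stick out of \<open>{a..b}\<close>.\<close>
  have "a \<le> a \<longrightarrow> b \<le> b \<longrightarrow> rectifiable g a b"
  proof (rule Bolzano[OF ab, where P = "\<lambda>u v. a \<le> u \<longrightarrow> v \<le> b \<longrightarrow> rectifiable g u v"])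
    show "\<exists>d>0. \<forall>u v. u \<le> x \<and> x \<le> v \<and> v - u < d \<longrightarrow> a \<le> u \<longrightarrow> v \<le> b \<longrightarrow> rectifiable g u v"
      if x: "a \<le> x" "x \<le> b" for x
    proof -
      obtain \<eta> where \<eta>: "\<eta> > 0" "\<And>y. y \<in> {a..b} \<Longrightarrow> dist y x < \<eta> \<Longrightarrow> dist (g y) (g x) < \<delta> / 2"
        using cont C(2) x unfolding continuous_on_iff by (metis atLeastAtMost_iff half_gt_zero)
      have "rectifiable g u v" if uv: "u \<le> x" "x \<le> v" "v - u < \<eta>" "a \<le> u" "v \<le> b" for u v
      proof -
        have "dist (g w) (g u) \<le> \<delta>" if "w \<in> {u..v}" for w
        proof -
          have "dist w x < \<eta>" "dist u x < \<eta>" using that uv by (auto simp: dist_real_def)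
          then have "dist (g w) (g x) < \<delta> / 2" "dist (g u) (g x) < \<delta> / 2" using \<eta>(2) that uv by auto
          then show ?thesis using dist_triangle2[of "g w" "g u" "g x"] by linarith
        qed
        then have "S \<le> C * \<delta>" if "S \<in> inscribed_lengths g u v" for S
          using C(3)[of u v \<delta> S] that uv by auto
        then show ?thesis unfolding rectifiable_def bdd_above_def by blast
      qed
      then show ?thesis using \<eta>(1) by blast
    qed
  qed (auto intro: rectifiable_trans)
  then show ?thesis by simp
qed

lemma R_path_continuous_arc_length:
  assumes "R > 0" and path: "R_path R a b g"
  shows "continuous_on {a..b} (arc_length g a)"
proof -
  have rect: "rectifiable g a b" by (rule R_path_rectifiable[OF assms])
  have cont: "continuous_on {a..b} g" using path by (auto simp: R_path_def)
  obtain C \<delta> where C: "C \<ge> 0" "\<delta> > 0"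
    "\<And>s t D S. \<lbrakk>a \<le> s; s \<le> t; t \<le> b; \<And>u. u \<in> {s..t} \<Longrightarrow> dist (g u) (g s) \<le> D; D \<le> \<delta>;
       S \<in> inscribed_lengths g s t\<rbrakk> \<Longrightarrow> S \<le> C * D"
    using R_path_inscribed_length_le[OF assms] by metis
  have uc: "uniformly_continuous_on {a..b} g" using cont by (intro compact_uniformly_continuous) auto
  show ?thesis
    unfolding continuous_on_iff
  proof (intro ballI allI impI)
    fix x e :: real assume x: "x \<in> {a..b}" and e: "e > 0"
    \<comment> \<open>The denominator \<open>C + 1\<close> avoids division by zero and makes
      \<open>C * D < e\<close> strict.\<close>
    define D where "D = min \<delta> (e / (C + 1))"
    have D: "D > 0" "D \<le> \<delta>" using C e by (auto simp: D_def)
    have CD: "C * D < e"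
    proof -
      have "C * D < (C + 1) * D" using D(1) by simp
      also have "\<dots> \<le> (C + 1) * (e / (C + 1))" using C(1) by (intro mult_left_mono) (auto simp: D_def)
      also have "\<dots> = e" using C(1) by simp
      finally show ?thesis .
    qed
    obtain \<eta> where \<eta>: "\<eta> > 0" "\<And>u v. u \<in> {a..b} \<Longrightarrow> v \<in> {a..b} \<Longrightarrow> dist u v < \<eta> \<Longrightarrow> dist (g u) (g v) < D"
      using uc D(1) unfolding uniformly_continuous_on_def by metis
    have step: "\<bar>arc_length g a t - arc_length g a s\<bar> < e" if st: "a \<le> s" "s \<le> t" "t \<le> b" "t - s < \<eta>" for s t
    proof -
      have "dist (g u) (g s) \<le> D" if "u \<in> {s..t}" for u
        using \<eta>(2)[of u s] that st by (auto simp: dist_real_def)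
      then have "arc_length g a t \<le> arc_length g a s + C * D"
        using arc_length_le_add[OF rect st(1,2,3)] C(3)[OF st(1,2,3) _ D(2)] by blast
      then show ?thesis
        using arc_length_add_dist_le[OF rect st(1,2,3)] zero_le_dist[of "g s" "g t"] CD by linarith
    qed
    have "dist (arc_length g a y) (arc_length g a x) < e" if "y \<in> {a..b}" "dist y x < \<eta>" for y
      using step[of x y] step[of y x] that x by (cases "x \<le> y") (auto simp: dist_real_def abs_minus_commute)
    then show "\<exists>d>0. \<forall>y\<in>{a..b}. dist y x < d \<longrightarrow> dist (arc_length g a y) (arc_length g a x) < e"
      using \<eta>(1) by blast
  qed
qed

subsection \<open>Curves parametrized by arc length\<close>

text \<open>The increments are lengths of disjoint intervals inside \<open>{f p..f q}\<close>, so
  additivity of measure applies without sorting. Open intervals are taken since closed ones share an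
  endpoint where \<open>f\<close> is constant in between.\<close>

lemma sum_increments_le:
  fixes f :: "real \<Rightarrow> real"
  assumes I: "finite I" and mono: "mono_on {p..q} f" and pq: "p \<le> q"
    and sub: "\<And>u v. (u, v) \<in> I \<Longrightarrow> p \<le> u \<and> u \<le> v \<and> v \<le> q"
    and disj: "pairwise (\<lambda>i j. disjnt {fst i..snd i} {fst j..snd j}) I"
  shows "(\<Sum>(u,v)\<in>I. f v - f u) \<le> f q - f p"
proof -
  define A where "A i = {f (fst i)<..<f (snd i)}" for i
  have mo: "f s \<le> f t" if "p \<le> s" "s \<le> t" "t \<le> q" for s t
    using monotone_onD[OF mono, of s t] that by auto
  have "A i \<inter> A j = {}" if ij: "i \<in> I" "j \<in> I" "i \<noteq> j" for i j
  proof -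
    have b: "p \<le> fst i" "fst i \<le> snd i" "snd i \<le> q" "p \<le> fst j" "fst j \<le> snd j" "snd j \<le> q"
      using sub[of "fst i" "snd i"] sub[of "fst j" "snd j"] ij by auto
    have "disjnt {fst i..snd i} {fst j..snd j}" using disj ij unfolding pairwise_def by blast
    moreover have "max (fst i) (fst j) \<in> {fst i..snd i} \<inter> {fst j..snd j}"
      if "\<not> snd i < fst j" "\<not> snd j < fst i" using that b by auto
    ultimately consider "snd i < fst j" | "snd j < fst i" unfolding disjnt_def by blast
    then show ?thesis
    proof cases
      case 1
      then have "f (snd i) \<le> f (fst j)" using b by (intro mo) auto
      then show ?thesis by (auto simp: A_def)
    next
      case 2
      then have "f (snd j) \<le> f (fst i)" using b by (intro mo) auto
      then show ?thesis by (auto simp: A_def)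
    qed
  qed
  then have dis: "disjoint_family_on A I" unfolding disjoint_family_on_def by blast
  have "(\<Sum>(u,v)\<in>I. f v - f u) = (\<Sum>i\<in>I. measure lborel (A i))"
  proof (rule sum.cong[OF refl])
    fix i assume "i \<in> I"
    then have "f (fst i) \<le> f (snd i)" using sub[of "fst i" "snd i"] by (intro mo) auto
    then show "(case i of (u, v) \<Rightarrow> f v - f u) = measure lborel (A i)"
      by (simp add: A_def split_beta)
  qed
  also have "\<dots> = measure lborel (\<Union>i\<in>I. A i)"
  proof (rule measure_finite_Union[symmetric, OF I _ dis])
    show "emeasure lborel (A i) \<noteq> \<infinity>" for i
      using emeasure_bounded_finite[of "A i"] by (simp add: A_def less_top)
  qed (auto simp: A_def)
  also have "\<dots> \<le> measure lborel {f p..f q}"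
  proof (rule measure_mono_fmeasurable)
    show "(\<Union>i\<in>I. A i) \<subseteq> {f p..f q}"
    proof
      fix z assume "z \<in> (\<Union>i\<in>I. A i)"
      then obtain i where i: "i \<in> I" "f (fst i) < z" "z < f (snd i)" by (auto simp: A_def)
      then have "f p \<le> f (fst i)" "f (snd i) \<le> f q"
        using sub[of "fst i" "snd i"] by (auto intro!: mo)
      then show "z \<in> {f p..f q}" using i by auto
    qed
    show "(\<Union>i\<in>I. A i) \<in> sets lborel" using I by (intro sets.finite_UN) (auto simp: A_def)
  qed (auto intro!: fmeasurable_compact)
  also have "\<dots> = f q - f p" using mo[of p q] pq by simp
  finally show ?thesis .
qed

text \<open>The steep intervals form a Vitali cover of \<open>E\<close>, so a disjoint family covers
  it up to a null set. Each length is at most the increment divided by \<open>\<mu>\<close>, and the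
  increments of disjoint intervals add up to at most \<open>f q - f p\<close>.\<close>

lemma mono_steep_points_cover:
  fixes f :: "real \<Rightarrow> real"
  assumes mono: "mono_on {p..q} f" and pq: "p \<le> q" and l: "\<mu> > 0"
    and E: "\<And>s \<eta>. s \<in> E \<Longrightarrow> \<eta> > 0 \<Longrightarrow>
      \<exists>u v. p \<le> u \<and> u \<le> s \<and> s \<le> v \<and> v \<le> q \<and> u < v \<and> v - u < \<eta> \<and> \<mu> * (v - u) \<le> f v - f u"
  shows "\<exists>T\<in>lmeasurable. E \<subseteq> T \<and> measure lebesgue T \<le> (f q - f p) / \<mu>"
proof -
  define K where "K = {(u, v). p \<le> u \<and> u < v \<and> v \<le> q \<and> \<mu> * (v - u) \<le> f v - f u}"
  \<comment> \<open>Intervals are recoded by midpoint and half length as the closed balls of the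
    covering theorem.\<close>
  define a where "a i = (fst i + snd i) / 2" for i :: "real \<times> real"
  define r where "r i = (snd i - fst i) / 2" for i :: "real \<times> real"
  have cb: "cball (a i) (r i) = {fst i..snd i}" for i
    unfolding cball_eq_atLeastAtMost a_def r_def by (simp add: field_simps)
  obtain C where C: "countable C" "C \<subseteq> K"
     "pairwise (\<lambda>i j. disjnt (cball (a i) (r i)) (cball (a j) (r j))) C"
     "negligible (E - (\<Union>i\<in>C. cball (a i) (r i)))"
  proof (rule Vitali_covering_theorem_cballs[of K r E a])
    show "0 < r i" if "i \<in> K" for i using that by (auto simp: K_def r_def)
    show "\<exists>i. i \<in> K \<and> s \<in> cball (a i) (r i) \<and> r i < d" if s: "s \<in> E" "0 < d" for s d
    proof -
      obtain u v where uv: "p \<le> u" "u \<le> s" "s \<le> v" "v \<le> q" "u < v" "v - u < d" "\<mu> * (v - u) \<le> f v - f u"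
        using E[OF s] by blast
      then have "(u, v) \<in> K" "s \<in> cball (a (u, v)) (r (u, v))" "r (u, v) < d"
        unfolding cb by (auto simp: K_def r_def)
      then show ?thesis by blast
    qed
  qed (use that in auto)
  let ?N = "E - (\<Union>i\<in>C. cball (a i) (r i))"
  have le: "measure lebesgue (\<Union>i\<in>I. cball (a i) (r i)) \<le> (f q - f p) / \<mu>"
    if I: "I \<subseteq> C" "finite I" for I
  proof -
    have K: "p \<le> u" "u < v" "v \<le> q" "\<mu> * (v - u) \<le> f v - f u" if "(u, v) \<in> I" for u v
      using that I C(2) by (auto simp: K_def)
    have "measure lebesgue (\<Union>i\<in>I. cball (a i) (r i)) \<le> (\<Sum>i\<in>I. measure lebesgue (cball (a i) (r i)))"
      using I by (intro measure_UNION_le) auto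
    also have "\<dots> = (\<Sum>(u,v)\<in>I. v - u)"
      unfolding cb using K by (intro sum.cong) force+
    also have "\<dots> \<le> (\<Sum>(u,v)\<in>I. (f v - f u) / \<mu>)"
      using K(4) l by (intro sum_mono) (auto simp: pos_le_divide_eq mult.commute)
    also have "\<dots> = (\<Sum>(u,v)\<in>I. f v - f u) / \<mu>"
      by (simp add: sum_divide_distrib split_beta)
    also have "\<dots> \<le> (f q - f p) / \<mu>"
    proof (rule divide_right_mono)
      have "pairwise (\<lambda>i j. disjnt {fst i..snd i} {fst j..snd j}) I"
        using C(3) I(1) unfolding cb by (rule pairwise_subset)
      moreover have "p \<le> u \<and> u \<le> v \<and> v \<le> q" if "(u, v) \<in> I" for u v using K[OF that] by simp
      ultimately show "(\<Sum>(u,v)\<in>I. f v - f u) \<le> f q - f p"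
        using sum_increments_le[OF I(2) mono pq] by blast
    qed (use l in simp)
    finally show ?thesis .
  qed
  have cbm: "cball (a i) (r i) \<in> lmeasurable" for i by simp
  have U: "(\<Union>i\<in>C. cball (a i) (r i)) \<in> lmeasurable"
    by (rule fmeasurable_UN_bound[OF C(1) cbm le])
  have N: "?N \<in> lmeasurable" "measure lebesgue ?N = 0"
    using C(4) by (auto simp: negligible_imp_measurable negligible_imp_measure0)
  show ?thesis
  proof (intro bexI conjI)
    show "E \<subseteq> (\<Union>i\<in>C. cball (a i) (r i)) \<union> ?N" by blast
    show "(\<Union>i\<in>C. cball (a i) (r i)) \<union> ?N \<in> lmeasurable" using U N by blast
    have "measure lebesgue ((\<Union>i\<in>C. cball (a i) (r i)) \<union> ?N) \<le>
        measure lebesgue (\<Union>i\<in>C. cball (a i) (r i)) + measure lebesgue ?N"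
      using U N by (intro measure_Un_le) auto
    also have "\<dots> \<le> (f q - f p) / \<mu>"
      using measure_UN_bound[OF C(1) cbm le] N by simp
    finally show "measure lebesgue ((\<Union>i\<in>C. cball (a i) (r i)) \<union> ?N) \<le> (f q - f p) / \<mu>" .
  qed
qed

text \<open>Differentiability with unit derivative up to a fixed error; \<open>e\<close> may vary
  with \<open>\<kappa>\<close>, and its convergence is shown afterwards.\<close>

definition near_unit_slope :: "(real \<Rightarrow> 'a::real_normed_vector) \<Rightarrow> real set \<Rightarrow> real \<Rightarrow> real \<Rightarrow> bool" where
  "near_unit_slope x I \<kappa> s \<longleftrightarrow> (\<exists>e. norm e = 1 \<and> (\<exists>\<eta>>0. \<forall>s'\<in>I. \<bar>s' - s\<bar> < \<eta> \<longrightarrow>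
      norm (x s' - x s - (s' - s) *\<^sub>R e) \<le> \<kappa> * \<bar>s' - s\<bar>))"

text \<open>With \<open>e\<close> the direction of the chord, \<open>\<lambda>s. s - e \<bullet> x s\<close> is nondecreasing with total increase the
  length defect of the chord, and wherever it is not steep the slopes of \<open>x\<close> are close to \<open>e\<close>.\<close>

lemma Lipschitz_near_unit_slope_cover:
  fixes x :: "real \<Rightarrow> 'a::euclidean_space"
  assumes lip: "\<And>u v. u \<in> {p..q} \<Longrightarrow> v \<in> {p..q} \<Longrightarrow> dist (x u) (x v) \<le> dist u v"
    and pq: "p \<le> q" and k: "\<kappa> > 0"
  shows "\<exists>T\<in>lmeasurable. measure lebesgue T \<le> (q - p - dist (x p) (x q)) / (\<kappa>\<^sup>2 / 2) \<and>
     (\<forall>s\<in>{p<..<q} - T. near_unit_slope x I \<kappa> s)"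
proof -
  obtain e where e: "norm e = 1" "e \<bullet> (x q - x p) = dist (x p) (x q)"
  proof (cases "x p = x q")
    case True
    then show thesis using that vector_choose_size[of 1] by (metis cancel_comm_monoid_add_class.diff_cancel dist_self inner_zero_right zero_le_one)
  next
    case False
    let ?e = "(x q - x p) /\<^sub>R dist (x p) (x q)"
    have "norm ?e = 1" using False by (simp add: dist_norm norm_minus_commute)
    moreover have "?e \<bullet> (x q - x p) = dist (x p) (x q)"
      using False by (simp add: dist_norm norm_minus_commute divide_inverse[symmetric] dot_square_norm power2_eq_square)
    ultimately show thesis by (rule that)
  qed
  define f where "f s = s - e \<bullet> x s" for s
  have ineq: "e \<bullet> (x v - x u) \<le> v - u" if "p \<le> u" "u \<le> v" "v \<le> q" for u v
  proof -
    have "e \<bullet> (x v - x u) \<le> norm e * norm (x v - x u)" by (rule norm_cauchy_schwarz)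
    also have "\<dots> = dist (x v) (x u)" using e(1) by (simp add: dist_norm)
    also have "\<dots> \<le> dist v u" using that by (intro lip) auto
    finally show ?thesis using that by (simp add: dist_real_def)
  qed
  have mono: "mono_on {p..q} f"
    using ineq by (auto simp: monotone_on_def f_def inner_diff_right algebra_simps)
  define E where "E = {s. \<forall>\<eta>>0. \<exists>u v. p \<le> u \<and> u \<le> s \<and> s \<le> v \<and> v \<le> q \<and> u < v \<and> v - u < \<eta> \<and>
      \<kappa>\<^sup>2 / 2 * (v - u) \<le> f v - f u}"
  have "\<kappa>\<^sup>2 / 2 > 0" using k by simp
  then obtain T where T: "T \<in> lmeasurable" "E \<subseteq> T" "measure lebesgue T \<le> (f q - f p) / (\<kappa>\<^sup>2 / 2)"
    using mono_steep_points_cover[OF mono pq, of "\<kappa>\<^sup>2 / 2" E] unfolding E_def by blast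
  have "f q - f p = q - p - dist (x p) (x q)" using e(2) by (simp add: f_def inner_diff_right)
  moreover have "near_unit_slope x I \<kappa> s" if s: "s \<in> {p<..<q} - T" for s
  proof -
    have "s \<notin> E" using s T(2) by blast
    then obtain \<eta> where \<eta>: "\<eta> > 0" "\<And>u v. p \<le> u \<Longrightarrow> u \<le> s \<Longrightarrow> s \<le> v \<Longrightarrow> v \<le> q \<Longrightarrow> u < v \<Longrightarrow> v - u < \<eta> \<Longrightarrow>
      f v - f u < \<kappa>\<^sup>2 / 2 * (v - u)"
      unfolding E_def mem_Collect_eq by (meson not_le)
    \<comment> \<open>With \<open>h = v - u\<close>, expanding the square gives at most \<open>2 *
      h\<^sup>2 - 2 * h\<^sup>2 * (1 - \<kappa>\<^sup>2 / 2) = \<kappa>\<^sup>2 * h\<^sup>2\<close>;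
      hence the threshold \<open>\<kappa>\<^sup>2 / 2\<close> for steepness.\<close>
    have close: "norm (x v - x u - (v - u) *\<^sub>R e) \<le> \<kappa> * (v - u)"
      if uv: "p \<le> u" "u \<le> s" "s \<le> v" "v \<le> q" "u < v" "v - u < \<eta>" for u v
    proof -
      have "(norm (x v - x u))\<^sup>2 \<le> (v - u)\<^sup>2"
        using lip[of v u] uv by (intro power_mono) (auto simp: dist_norm)
      moreover have "(v - u) * ((v - u) - \<kappa>\<^sup>2 / 2 * (v - u)) \<le> (v - u) * (e \<bullet> (x v - x u))"
      proof (rule mult_left_mono)
        have "f v - f u = (v - u) - e \<bullet> (x v - x u)" by (simp add: f_def inner_diff_right)
        then show "(v - u) - \<kappa>\<^sup>2 / 2 * (v - u) \<le> e \<bullet> (x v - x u)" using \<eta>(2)[OF uv] by linarith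
      qed (use uv in simp)
      moreover have "(norm (x v - x u - (v - u) *\<^sub>R e))\<^sup>2 =
          (norm (x v - x u))\<^sup>2 + (v - u)\<^sup>2 - 2 * ((v - u) * (e \<bullet> (x v - x u)))"
      proof -
        have "(norm (w - c *\<^sub>R e))\<^sup>2 = (norm w)\<^sup>2 + c\<^sup>2 * (e \<bullet> e) - 2 * (c * (e \<bullet> w))" for w c
          unfolding power2_norm_eq_inner
          by (simp add: inner_diff_left inner_diff_right inner_commute power2_eq_square algebra_simps)
        then show ?thesis using e(1) by (simp add: norm_eq_1)
      qed
      moreover have "(v - u) * ((v - u) - \<kappa>\<^sup>2 / 2 * (v - u)) = (v - u)\<^sup>2 - (\<kappa> * (v - u))\<^sup>2 / 2"
        by (simp add: power2_eq_square algebra_simps)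
      ultimately have "(norm (x v - x u - (v - u) *\<^sub>R e))\<^sup>2 \<le> (\<kappa> * (v - u))\<^sup>2" by linarith
      then show ?thesis by (rule power2_le_imp_le) (use k uv in simp)
    qed
    \<comment> \<open>This radius keeps \<open>s'\<close> inside \<open>{p..q}\<close>, where the
      Lipschitz bound holds, whatever \<open>I\<close> is.\<close>
    define \<eta>' where "\<eta>' = min \<eta> (min (s - p) (q - s))"
    have "norm (x s' - x s - (s' - s) *\<^sub>R e) \<le> \<kappa> * \<bar>s' - s\<bar>" if s': "\<bar>s' - s\<bar> < \<eta>'" for s'
    proof -
      have b: "p \<le> s'" "s' \<le> q" "\<bar>s' - s\<bar> < \<eta>" using s' by (auto simp: \<eta>'_def)
      consider "s' = s" | "s' > s" | "s' < s" by linarith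
      then show ?thesis
      proof cases
        case 2
        then show ?thesis using close[of s s'] s b by auto
      next
        case 3
        have "x s' - x s - (s' - s) *\<^sub>R e = - (x s - x s' - (s - s') *\<^sub>R e)" by (simp add: algebra_simps)
        then show ?thesis using close[of s' s] s b 3 by (metis abs_minus_commute abs_of_pos
              diff_gt_0_iff_gt greaterThanLessThan_iff DiffD1 less_imp_le norm_minus_cancel order_refl)
      qed simp
    qed
    moreover have "\<eta>' > 0" using \<eta> s by (auto simp: \<eta>'_def)
    ultimately show ?thesis unfolding near_unit_slope_def using e(1) by blast
  qed
  ultimately show ?thesis using T(1,3) by auto
qed

lemma mono_partition_cases:
  fixes q :: "nat \<Rightarrow> real"
  assumes "q 0 \<le> s" "s \<le> q n"
  shows "s \<in> q ` {..n} \<or> (\<exists>i<n. s \<in> {q i<..<q (Suc i)})"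
  using assms(2)
proof (induction n)
  case 0
  then show ?case using assms(1) by auto
next
  case (Suc n)
  consider "s \<le> q n" | "s = q (Suc n)" | "q n < s" "s < q (Suc n)" using Suc.prems by linarith
  then show ?case
  proof cases
    case 1
    from Suc.IH[OF this] show ?thesis by (auto simp: less_Suc_eq)
  qed auto
qed

text \<open>Along a polygon with length defect below
  \<open>\<epsilon> * (\<kappa>\<^sup>2 / 2)\<close>, the exceptional set of each edge has measure
  at most the defect of that edge divided by \<open>\<kappa>\<^sup>2 / 2\<close>. The defects add
  up, so the total is at most \<open>\<epsilon>\<close>; the nodes form a finite set.\<close>

lemma negligible_not_near_unit_slope:
  fixes x :: "real \<Rightarrow> 'a::euclidean_space"
  assumes lip: "\<And>u v. u \<in> {0..L} \<Longrightarrow> v \<in> {0..L} \<Longrightarrow> dist (x u) (x v) \<le> dist u v"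
    and len: "\<And>\<epsilon>. \<epsilon> > 0 \<Longrightarrow> \<exists>n q. mono_on {..n::nat} q \<and> q 0 = 0 \<and> q n = L \<and>
        L - \<epsilon> < (\<Sum>i<n. dist (x (q i)) (x (q (Suc i))))"
    and k: "\<kappa> > 0"
  shows "negligible {s \<in> {0..L}. \<not> near_unit_slope x {0..L} \<kappa> s}"
  unfolding negligible_outer_le
proof (intro allI impI)
  fix \<epsilon> :: real assume e: "\<epsilon> > 0"
  then have "\<epsilon> * (\<kappa>\<^sup>2 / 2) > 0" using k by simp
  then obtain n q where q: "mono_on {..n::nat} q" "q 0 = 0" "q n = L"
      "L - \<epsilon> * (\<kappa>\<^sup>2 / 2) < (\<Sum>i<n. dist (x (q i)) (x (q (Suc i))))"
    using len by blast
  have step: "q i \<le> q (Suc i)" "{q i..q (Suc i)} \<subseteq> {0..L}" if "i < n" for i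
    using monotone_onD[OF q(1), of i "Suc i"] monotone_onD[OF q(1), of 0 i]
      monotone_onD[OF q(1), of "Suc i" n] that q(2,3) by auto
  have "\<exists>T\<in>lmeasurable. measure lebesgue T \<le> (q (Suc i) - q i - dist (x (q i)) (x (q (Suc i)))) / (\<kappa>\<^sup>2 / 2) \<and>
     (\<forall>s\<in>{q i<..<q (Suc i)} - T. near_unit_slope x {0..L} \<kappa> s)" if "i < n" for i
    using step[OF that] by (intro Lipschitz_near_unit_slope_cover lip k) auto
  then obtain T where T: "\<And>i. i < n \<Longrightarrow> T i \<in> lmeasurable"
     "\<And>i. i < n \<Longrightarrow> measure lebesgue (T i) \<le> (q (Suc i) - q i - dist (x (q i)) (x (q (Suc i)))) / (\<kappa>\<^sup>2 / 2)"
     "\<And>i s. i < n \<Longrightarrow> s \<in> {q i<..<q (Suc i)} - T i \<Longrightarrow> near_unit_slope x {0..L} \<kappa> s"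
    by metis
  have Q: "negligible (q ` {..n})" by (intro negligible_finite) simp
  have TU: "(\<Union>i<n. T i) \<in> lmeasurable" using T(1) by (intro fmeasurable.finite_UN) auto
  show "\<exists>U. {s \<in> {0..L}. \<not> near_unit_slope x {0..L} \<kappa> s} \<subseteq> U \<and> U \<in> lmeasurable \<and> measure lebesgue U \<le> \<epsilon>"
  proof (intro exI conjI)
    show "{s \<in> {0..L}. \<not> near_unit_slope x {0..L} \<kappa> s} \<subseteq> (\<Union>i<n. T i) \<union> q ` {..n}"
    proof
      fix s assume s: "s \<in> {s \<in> {0..L}. \<not> near_unit_slope x {0..L} \<kappa> s}"
      then show "s \<in> (\<Union>i<n. T i) \<union> q ` {..n}"
        using mono_partition_cases[of q s n] q(2,3) T(3) by auto
    qed
    show "(\<Union>i<n. T i) \<union> q ` {..n} \<in> lmeasurable"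
      by (rule fmeasurable.Un[OF TU negligible_imp_measurable[OF Q]])
    have "measure lebesgue ((\<Union>i<n. T i) \<union> q ` {..n}) \<le> measure lebesgue (\<Union>i<n. T i) + measure lebesgue (q ` {..n})"
      by (rule measure_Un_le[OF fmeasurableD[OF TU] fmeasurableD[OF negligible_imp_measurable[OF Q]]])
    also have "\<dots> \<le> (\<Sum>i<n. measure lebesgue (T i))"
      using measure_UNION_le[of "{..<n}" T lebesgue] T(1) Q by (auto simp: negligible_imp_measure0 fmeasurableD)
    also have "\<dots> \<le> (\<Sum>i<n. (q (Suc i) - q i - dist (x (q i)) (x (q (Suc i)))) / (\<kappa>\<^sup>2 / 2))"
      using T(2) by (intro sum_mono) auto
    also have "\<dots> = (L - (\<Sum>i<n. dist (x (q i)) (x (q (Suc i))))) / (\<kappa>\<^sup>2 / 2)"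
      using sum_lessThan_telescope[of q n] q(2,3)
      by (simp only: sum_divide_distrib[symmetric] sum_subtractf) simp
    also have "\<dots> \<le> \<epsilon> * (\<kappa>\<^sup>2 / 2) / (\<kappa>\<^sup>2 / 2)"
      using q(4) by (intro divide_right_mono) auto
    also have "\<dots> = \<epsilon>" using k by simp
    finally show "measure lebesgue ((\<Union>i<n. T i) \<union> q ` {..n}) \<le> \<epsilon>" .
  qed
qed

text \<open>Directions belonging to two error levels describe the same increment at a common small
  forward step \<open>h\<close>, so they differ by at most the sum of the levels. They form a Cauchy
  sequence, whose limit is the derivative.\<close>

lemma near_unit_slopes_imp_derivative:
  fixes x :: "real \<Rightarrow> 'a::banach"
  assumes near: "\<And>\<kappa>. \<kappa> > 0 \<Longrightarrow> near_unit_slope x {a..b} \<kappa> s"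
    and s: "s \<in> {a..<b}"
  shows "\<exists>v. norm v = 1 \<and> (x has_vector_derivative v) (at s within {a..b})"
proof -
  define \<kappa> where "\<kappa> n = 1 / real (Suc n)" for n
  have k0: "\<kappa> n > 0" for n by (simp add: \<kappa>_def)
  have klim: "\<kappa> \<longlonglongrightarrow> 0" unfolding \<kappa>_def by (rule LIMSEQ_Suc[OF lim_1_over_n])
  have "\<forall>n. \<exists>e. norm e = 1 \<and> (\<exists>\<eta>>0. \<forall>s'\<in>{a..b}. \<bar>s' - s\<bar> < \<eta> \<longrightarrow>
      norm (x s' - x s - (s' - s) *\<^sub>R e) \<le> \<kappa> n * \<bar>s' - s\<bar>)"
    using near[OF k0] unfolding near_unit_slope_def by blast
  then obtain e where "\<forall>n. norm (e n) = 1 \<and> (\<exists>\<eta>>0. \<forall>s'\<in>{a..b}. \<bar>s' - s\<bar> < \<eta> \<longrightarrow>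
      norm (x s' - x s - (s' - s) *\<^sub>R e n) \<le> \<kappa> n * \<bar>s' - s\<bar>)"
    by (rule choice[THEN exE])
  then obtain \<eta> where e: "\<And>n. norm (e n) = 1" and \<eta>: "\<And>n. \<eta> n > 0"
    "\<And>n s'. s' \<in> {a..b} \<Longrightarrow> \<bar>s' - s\<bar> < \<eta> n \<Longrightarrow> norm (x s' - x s - (s' - s) *\<^sub>R e n) \<le> \<kappa> n * \<bar>s' - s\<bar>"
    by metis
  have ee: "norm (e m - e n) \<le> \<kappa> m + \<kappa> n" for m n
  proof -
    define h where "h = min (min (\<eta> m) (\<eta> n)) (b - s) / 2"
    have h: "h > 0" "h < \<eta> m" "h < \<eta> n" "h < b - s"
      using \<eta>(1)[of m] \<eta>(1)[of n] s by (auto simp: h_def min_def)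
    then have sh: "s + h \<in> {a..b}" using s by simp
    have "h *\<^sub>R (e m - e n) = (x (s + h) - x s - h *\<^sub>R e n) - (x (s + h) - x s - h *\<^sub>R e m)"
      by (simp add: algebra_simps)
    also have "norm \<dots> \<le> norm (x (s + h) - x s - h *\<^sub>R e n) + norm (x (s + h) - x s - h *\<^sub>R e m)"
      by (rule norm_triangle_ineq4)
    also have "\<dots> \<le> \<kappa> n * h + \<kappa> m * h"
      using \<eta>(2)[OF sh, of n] \<eta>(2)[OF sh, of m] h by (intro add_mono) auto
    finally have "h * norm (e m - e n) \<le> h * (\<kappa> m + \<kappa> n)"
      using h(1) unfolding norm_scaleR by (simp add: distrib_left mult.commute add.commute)
    then show ?thesis using h(1) by simp
  qed
  have "Cauchy e"
    unfolding Cauchy_altdef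
  proof (intro allI impI)
    fix r :: real assume "r > 0"
    then have "\<forall>\<^sub>F n in sequentially. \<kappa> n < r / 2" using order_tendstoD(2)[OF klim, of "r / 2"] by simp
    then obtain M where M: "\<And>n. n \<ge> M \<Longrightarrow> \<kappa> n < r / 2" unfolding eventually_sequentially by blast
    show "\<exists>M. \<forall>m\<ge>M. \<forall>n>m. dist (e m) (e n) < r"
    proof (intro exI[of _ M] allI impI)
      fix m n assume "m \<ge> M" "n > m"
      then show "dist (e m) (e n) < r" using ee[of m n] M[of m] M[of n] by (simp add: dist_norm)
    qed
  qed
  then obtain v where v: "e \<longlonglongrightarrow> v" by (metis Cauchy_convergent_iff convergent_def)
  have "norm v = 1" using tendsto_norm[OF v] e by (simp add: LIMSEQ_const_iff)
  moreover have ev: "norm (e m - v) \<le> \<kappa> m" for m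
  proof (rule LIMSEQ_le)
    show "(\<lambda>n. norm (e m - e n)) \<longlonglongrightarrow> norm (e m - v)" by (intro tendsto_intros v)
    show "(\<lambda>n. \<kappa> m + \<kappa> n) \<longlonglongrightarrow> \<kappa> m" using tendsto_add[OF tendsto_const klim, of "\<kappa> m"] by simp
  qed (use ee in blast)
  have "(x has_vector_derivative v) (at s within {a..b})"
    unfolding has_vector_derivative_def has_derivative_within_alt
  proof (intro conjI allI impI)
    show "bounded_linear (\<lambda>h. h *\<^sub>R v)" by (rule bounded_linear_scaleR_left)
    fix r :: real assume "r > 0"
    then have "\<forall>\<^sub>F n in sequentially. \<kappa> n < r / 2" using order_tendstoD(2)[OF klim, of "r / 2"] by simp
    then obtain n where n: "\<kappa> n < r / 2" unfolding eventually_sequentially by blast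
    have "norm (x y - x s - (y - s) *\<^sub>R v) \<le> r * norm (y - s)" if y: "y \<in> {a..b}" "norm (y - s) < \<eta> n" for y
    proof -
      have "x y - x s - (y - s) *\<^sub>R v = (x y - x s - (y - s) *\<^sub>R e n) + (y - s) *\<^sub>R (e n - v)"
        by (simp add: algebra_simps)
      also have "norm \<dots> \<le> norm (x y - x s - (y - s) *\<^sub>R e n) + norm ((y - s) *\<^sub>R (e n - v))"
        by (rule norm_triangle_ineq)
      also have "\<dots> \<le> \<kappa> n * \<bar>y - s\<bar> + \<bar>y - s\<bar> * \<kappa> n"
        using \<eta>(2)[of y n] y ev[of n] by (intro add_mono) (auto intro: mult_left_mono)
      also have "\<dots> = (2 * \<kappa> n) * \<bar>y - s\<bar>" by simp
      also have "\<dots> \<le> r * \<bar>y - s\<bar>" using n by (intro mult_right_mono) auto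
      finally show ?thesis by simp
    qed
    then show "\<exists>d>0. \<forall>y\<in>{a..b}. norm (y - s) < d \<longrightarrow> norm (x y - x s - (y - s) *\<^sub>R v) \<le> r * norm (y - s)"
      using \<eta>(1) by blast
  qed
  ultimately show ?thesis by blast
qed

lemma unit_speed_almost_everywhere:
  fixes x :: "real \<Rightarrow> 'a::euclidean_space"
  assumes lip: "\<And>u v. u \<in> {0..L} \<Longrightarrow> v \<in> {0..L} \<Longrightarrow> dist (x u) (x v) \<le> dist u v"
    and len: "\<And>\<epsilon>. \<epsilon> > 0 \<Longrightarrow> \<exists>n q. mono_on {..n::nat} q \<and> q 0 = 0 \<and> q n = L \<and>
        L - \<epsilon> < (\<Sum>i<n. dist (x (q i)) (x (q (Suc i))))"
  shows "\<exists>Z. negligible Z \<and> (\<forall>s\<in>{0..L} - Z. s < L \<and>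
      (\<exists>v. norm v = 1 \<and> (x has_vector_derivative v) (at s within {0..L})))"
proof -
  \<comment> \<open>The right endpoint \<open>L\<close> joins the exceptional set since it admits no
    forward step. The levels \<open>1 / real (Suc n)\<close> suffice because a smaller
    \<open>\<kappa>\<close> gives a stronger condition.\<close>
  define Z where "Z = insert L (\<Union>n. {s \<in> {0..L}. \<not> near_unit_slope x {0..L} (1 / real (Suc n)) s})"
  have "negligible Z"
    unfolding Z_def
    unfolding negligible_insert
    by (intro negligible_Union_nat negligible_not_near_unit_slope lip len) auto
  moreover have "s < L \<and> (\<exists>v. norm v = 1 \<and> (x has_vector_derivative v) (at s within {0..L}))"
    if s: "s \<in> {0..L} - Z" for s
  proof -
    have near: "near_unit_slope x {0..L} \<kappa> s" if k: "\<kappa> > 0" for \<kappa>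
    proof -
      obtain n where n: "1 / real (Suc n) < \<kappa>" using nat_approx_posE[OF k] by (metis of_nat_Suc add.commute)
      have "near_unit_slope x {0..L} (1 / real (Suc n)) s" using s unfolding Z_def by blast
      then show ?thesis
        unfolding near_unit_slope_def using n
        by (meson abs_ge_zero less_imp_le mult_right_mono order_trans)
    qed
    have "s \<in> {0..<L}" using s by (auto simp: Z_def)
    then show ?thesis using near_unit_slopes_imp_derivative[OF near] by auto
  qed
  ultimately show ?thesis by blast
qed

section \<open>The arc length representation of an R-path and the R-curve inequality\<close>

lemma arc_length_self: "arc_length g a a = 0"
proof -
  have "S = 0" if "S \<in> inscribed_lengths g a a" for S
  proof -
    obtain n p where p: "mono_on {..n::nat} p" "p 0 = a" "p n = a"
      "S = (\<Sum>i<n. dist (g (p i)) (g (p (Suc i))))"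
      using \<open>S \<in> inscribed_lengths g a a\<close> unfolding inscribed_lengths_def by blast
    have "p i = a" if "i \<le> n" for i
      using monotone_onD[OF p(1), of 0 i] monotone_onD[OF p(1), of i n] p(2,3) that by auto
    then show ?thesis using p(4) by simp
  qed
  moreover have "inscribed_lengths g a a \<noteq> {}" using dist_in_inscribed_lengths[of a a g] by blast
  ultimately have "inscribed_lengths g a a = {0}" by blast
  then show ?thesis by (simp add: arc_length_def)
qed

theorem theorem5p4:
  fixes R a b :: real and g :: "real \<Rightarrow> real^2"
  assumes "R > 0" and "R_path R a b g"
  shows "R_curve R a b g"
proof -
  note Rpos = assms(1) and path = assms(2)
  have ab: "a < b" and cont: "continuous_on {a..b} g" using path by (auto simp: R_path_def)
  have rect: "rectifiable g a b" by (rule R_path_rectifiable[OF assms])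
  define len where "len = arc_length g a"
  define L where "L = len b"
  have l0: "len a = 0" by (simp add: len_def arc_length_self)
  have ldist: "dist (g s) (g t) \<le> len t - len s" if "a \<le> s" "s \<le> t" "t \<le> b" for s t
    using arc_length_add_dist_le[OF rect that] by (simp add: len_def)
  have lmono: "len s \<le> len t" if "a \<le> s" "s \<le> t" "t \<le> b" for s t
    using ldist[OF that] zero_le_dist[of "g s" "g t"] by linarith
  have lcont: "continuous_on {a..b} len" unfolding len_def by (rule R_path_continuous_arc_length[OF assms])
  have surj: "\<exists>t\<in>{a..b}. len t = \<sigma>" if "\<sigma> \<in> {0..L}" for \<sigma>
    using IVT'[of len a \<sigma> b] that l0 lcont ab unfolding L_def by force
  \<comment> \<open>Any parameter of arc length \<open>\<sigma>\<close> will do: by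
    \<open>geq\<close>, \<open>g\<close> is constant on the fibres of \<open>len\<close>.\<close>
  define x where "x \<sigma> = g (SOME t. t \<in> {a..b} \<and> len t = \<sigma>)" for \<sigma>
  have geq: "dist (g s) (g t) \<le> \<bar>len t - len s\<bar>" if "s \<in> {a..b}" "t \<in> {a..b}" for s t
    using ldist[of s t] ldist[of t s] that by (cases "s \<le> t") (auto simp: dist_commute)
  have xl: "x (len t) = g t" if "t \<in> {a..b}" for t
  proof -
    define u where "u = (SOME u. u \<in> {a..b} \<and> len u = len t)"
    have "u \<in> {a..b} \<and> len u = len t" unfolding u_def by (rule someI[of _ t]) (use that in simp)
    then show ?thesis using geq[of u t] that by (simp add: x_def u_def)
  qed
  have lip: "dist (x u) (x v) \<le> dist u v" if uv: "u \<in> {0..L}" "v \<in> {0..L}" for u v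
  proof -
    obtain s t where st: "s \<in> {a..b}" "t \<in> {a..b}" "len s = u" "len t = v" using surj uv by metis
    then show ?thesis using geq[OF st(1,2)] xl[OF st(1)] xl[OF st(2)] by (simp add: dist_real_def)
  qed
  \<comment> \<open>A polygon inscribed in \<open>g\<close> of nearly full length is carried over by
    \<open>len\<close>: its nodes become a partition of \<open>{0..L}\<close>, and its vertices are
    unchanged by \<open>xl\<close>.\<close>
  have approx: "\<exists>n q. mono_on {..n::nat} q \<and> q 0 = 0 \<and> q n = L \<and>
      L - \<epsilon> < (\<Sum>i<n. dist (x (q i)) (x (q (Suc i))))" if "\<epsilon> > 0" for \<epsilon>
  proof -
    have "inscribed_lengths g a b \<noteq> {}" using dist_in_inscribed_lengths[of a b g] ab by fastforce
    moreover have "L - \<epsilon> < Sup (inscribed_lengths g a b)" using that by (simp add: L_def len_def arc_length_def)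
    ultimately obtain S where S: "S \<in> inscribed_lengths g a b" "L - \<epsilon> < S"
      using less_cSupE by blast
    then obtain n p where p: "mono_on {..n::nat} p" "p 0 = a" "p n = b"
      "S = (\<Sum>i<n. dist (g (p i)) (g (p (Suc i))))"
      unfolding inscribed_lengths_def by blast
    have pab: "p i \<in> {a..b}" if "i \<le> n" for i
      using monotone_onD[OF p(1), of 0 i] monotone_onD[OF p(1), of i n] p(2,3) that by auto
    have "mono_on {..n} (\<lambda>i. len (p i))"
    proof (rule monotone_onI)
      fix i j assume "i \<in> {..n}" "j \<in> {..n}" "i \<le> j"
      then show "len (p i) \<le> len (p j)" using pab[of i] pab[of j] monotone_onD[OF p(1), of i j] by (intro lmono) auto
    qed
    moreover have "S = (\<Sum>i<n. dist (x (len (p i))) (x (len (p (Suc i)))))"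
      unfolding p(4) using pab by (intro sum.cong) (auto simp: xl)
    ultimately show ?thesis using S(2) p(2,3) l0
      by (intro exI[of _ n] exI[of _ "\<lambda>i. len (p i)"]) (simp add: L_def)
  qed
  obtain Z where Z: "negligible Z" "\<And>s. s \<in> {0..L} - Z \<Longrightarrow> s < L \<and>
      (\<exists>v. norm v = 1 \<and> (x has_vector_derivative v) (at s within {0..L}))"
    using unit_speed_almost_everywhere[OF lip approx] by blast
  have key: "\<exists>v. (x has_vector_derivative v) (at s within {0..L}) \<and>
              (\<forall>s1\<in>{0..s}. norm (x s1 - x s - R *\<^sub>R v) \<ge> R)" if s: "s \<in> {0..L} - Z" for s
  proof -
    obtain v where v: "s < L" "norm v = 1" "(x has_vector_derivative v) (at s within {0..L})"
      using Z(2)[OF s] by blast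
    obtain t where t: "t \<in> {a..b}" "len t = s" using surj s by blast
    have xs: "x s = g t" using xl t by blast
    have later: "x s' \<in> g ` {t..b}" if s': "s < s'" "s' \<le> L" for s'
    proof -
      obtain t' where t': "t' \<in> {a..b}" "len t' = s'" using surj[of s'] s' s by auto
      have "t \<le> t'" using lmono[of t' t] t t' s' by fastforce
      then show ?thesis using xl[OF t'(1)] t' by force
    qed
    \<comment> \<open>For \<open>s' = s\<close> the parameter \<open>t\<close> itself is used;
      another parameter with the same arc length could lie after \<open>t\<close>.\<close>
    have earlier: "x s' \<in> g ` {a..t}" if s': "0 \<le> s'" "s' \<le> s" for s'
    proof (cases "s' = s")
      case True
      then show ?thesis using xs t by auto
    next
      case False
      obtain t' where t': "t' \<in> {a..b}" "len t' = s'" using surj[of s'] s' s by auto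
      have "t' \<le> t" using lmono[of t t'] t t' s' False by fastforce
      then show ?thesis using xl[OF t'(1)] t' by force
    qed
    \<comment> \<open>Forward difference quotients tend to \<open>v\<close>, and the points
      \<open>x (s + h)\<close> lie on the later part of the path by \<open>later\<close>; the
      scaling factor in the tangent cone is \<open>inverse h\<close>.\<close>
    have "v \<in> tangent_cone (g ` {t..b}) (g t)"
      unfolding tangent_cone_def
    proof (intro CollectI allI impI)
      fix \<epsilon> :: real assume e: "\<epsilon> > 0"
      obtain d where d: "d > 0" "\<And>y. y \<in> {0..L} \<Longrightarrow> norm (y - s) < d \<Longrightarrow>
          norm (x y - x s - (y - s) *\<^sub>R v) \<le> \<epsilon> / 2 * norm (y - s)"
        using v(3) e half_gt_zero[OF e] unfolding has_vector_derivative_def has_derivative_within_alt by metis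
      define h where "h = min (min d \<epsilon>) (L - s) / 2"
      have h: "h > 0" "h < d" "h < \<epsilon>" "h < L - s"
        using d(1) e v(1) by (auto simp: h_def min_def)
      have sh: "s + h \<in> {0..L}" using h s by auto
      show "\<exists>y\<in>g ` {t..b}. \<exists>r>0. norm (y - g t) < \<epsilon> \<and> norm (r *\<^sub>R (y - g t) - v) < \<epsilon>"
      proof (intro bexI exI conjI)
        show "inverse h > 0" using h by simp
        show "x (s + h) \<in> g ` {t..b}" using h by (intro later) auto
        have "dist (x (s + h)) (x s) \<le> dist (s + h) s" using sh s by (intro lip) auto
        then show "norm (x (s + h) - g t) < \<epsilon>" using h xs by (simp add: dist_norm)
        have "norm (x (s + h) - x s - h *\<^sub>R v) \<le> \<epsilon> / 2 * h" using d(2)[OF sh] h by simp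
        moreover have "inverse h *\<^sub>R (x (s + h) - g t) - v = inverse h *\<^sub>R (x (s + h) - x s - h *\<^sub>R v)"
          using h by (simp add: xs scaleR_diff_right)
        then have "norm (inverse h *\<^sub>R (x (s + h) - g t) - v) = norm (x (s + h) - x s - h *\<^sub>R v) / h"
          using h by (simp only: norm_scaleR) (simp add: divide_inverse mult.commute)
        ultimately have "norm (inverse h *\<^sub>R (x (s + h) - g t) - v) \<le> \<epsilon> / 2"
          using h by (simp only: pos_divide_le_eq)
        then show "norm (inverse h *\<^sub>R (x (s + h) - g t) - v) < \<epsilon>" using e by simp
      qed
    qed
    then have free: "g ` {a..t} \<inter> ball (g t + R *\<^sub>R v) R = {}"
      using path t v(2) unfolding R_path_def by auto
    have "norm (x s1 - x s - R *\<^sub>R v) \<ge> R" if "s1 \<in> {0..s}" for s1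
    proof -
      have "x s1 \<notin> ball (g t + R *\<^sub>R v) R" using free earlier[of s1] that by auto
      then show ?thesis by (simp add: xs dist_norm norm_minus_commute algebra_simps)
    qed
    then show ?thesis using v(3) by blast
  qed
  have "Z \<in> null_sets lebesgue" using Z(1) by (simp add: negligible_iff_null_sets)
  then have "AE s in lebesgue. s \<notin> Z" by (rule AE_not_in)
  then have "AE s in lebesgue_on {0..L}. \<exists>v. (x has_vector_derivative v) (at s within {0..L}) \<and>
              (\<forall>s1\<in>{0..s}. norm (x s1 - x s - R *\<^sub>R v) \<ge> R)"
    by (subst AE_restrict_space_iff) (auto intro: key elim!: eventually_mono)
  moreover have "arc_length_representation g a b x"
    using xl by (simp add: arc_length_representation_def len_def)
  ultimately show ?thesis
    using ab cont rect unfolding R_curve_def L_def len_def by blast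
qed

end
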